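(* Let $a>b$ be coprime positive integers and let $\pi:K[Y]\to K[X]$ be the $K$-algebra homomorphism $y_{ij}\mapsto x_i^ax_j^b$ ($i\ne j$). Then the following binomials form an equivariant Markov basis of $\ker(\pi)$, i.e. their $S_\infty$-orbits generate the ideal $\ker(\pi)\subset K[Y]$: (i) $y_{12}y_{34}-y_{14}y_{32}$; (ii) $y_{12}y_{23}y_{31}-y_{21}y_{32}y_{13}$; (iii) for each $0\le n\le a-b$ and all finitely supported families of nonnegative integers $(c_{1j})_{j\ge3}$, $(c_{2j})_{j\ge 3}$ with $\sum_{j\ge3}c_{1j}=a-b-n$ and $\sum_{j\ge3}c_{2j}=n$, $$y_{12}^{b+n}\prod_{j\ge3}y_{j2}^{c_{1j}}y_{2j}^{c_{2j}}-y_{21}^{b+n}\prod_{j\ge3}y_{j1}^{c_{1j}}y_{1j}^{c_{2j}};$$ (iv) for each $1\le n\le b$, $$y_{12}^{b-n}y_{13}^{n}y_{32}^{a-b+n}-y_{21}^{b-n}y_{23}^{n}y_{31}^{a-b+n}.$$ The maximum degree of the binomials above is $\max(a+b,2a-b)$, and $$\operatorname{width}(\ker(\pi))=\max(4,a-b+2).$$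
   Context: $K$ is a (nonzero commutative) ring, $\mathbb{N}=\{1,2,\dots\}$, $K[Y]=K[y_{ij}\mid i,j\in\mathbb{N},\ i\ne j]$ and $K[X]=K[x_i\mid i\in\mathbb{N}]$. $S_\infty$ is the group of all bijections of $\mathbb{N}$, acting on $K[Y]$ by $\sigma(y_{ij})=y_{\sigma(i)\sigma(j)}$ and on $K[X]$ by $\sigma(x_i)=x_{\sigma(i)}$. The width of $\ker(\pi)$ is the least $n$ such that $\ker(\pi)$ is generated as an ideal by the $S_\infty$-orbits of the elements of its truncation $\ker(\pi)\cap K[y_{ij}\mid i,j\in\{1,\dots,n\},\ i\neq j]$. *)

theory Defs
  imports Complex_Main "HOL-Library.Poly_Mapping" "HOL-Library.Extended_Nat"
begin

section \<open>The index sets\<close>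

text \<open>The index set \<open>{1, 2, \<dots>}\<close>; the numerals denote the expected elements.\<close>

typedef pnat = "{n::nat. 0 < n}" morphisms nat_of_pnat Abs_pnat
  by (rule exI[of _ 1]) simp

instantiation pnat :: numeral
begin
definition one_pnat :: pnat where "1 = Abs_pnat 1"
definition plus_pnat :: "pnat \<Rightarrow> pnat \<Rightarrow> pnat" where
  "i + j = Abs_pnat (nat_of_pnat i + nat_of_pnat j)"
instance
proof
  fix i j k :: pnat
  have "nat_of_pnat (m + n) = nat_of_pnat m + nat_of_pnat n" for m n
    using nat_of_pnat[of m] by (simp add: plus_pnat_def Abs_pnat_inverse)
  then show "i + j + k = i + (j + k)"
    by (simp add: nat_of_pnat_inject[symmetric])
qed
end

lemma nat_of_pnat_one: "nat_of_pnat 1 = 1"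
  by (simp add: one_pnat_def Abs_pnat_inverse)

lemma nat_of_pnat_plus: "nat_of_pnat (i + j) = nat_of_pnat i + nat_of_pnat j"
  using nat_of_pnat[of i] by (simp add: plus_pnat_def Abs_pnat_inverse)

lemma nat_of_pnat_numeral: "nat_of_pnat (numeral k) = numeral k"
  by (induction k) (simp_all only: numeral.simps nat_of_pnat_one nat_of_pnat_plus)

text \<open>The index set of the variables \<open>y\<^sub>i\<^sub>j\<close>.\<close>

typedef offdiag = "{(i :: pnat, j). i \<noteq> j}" morphisms pair_of_offdiag Abs_offdiag
proof -
  have "(1::pnat) \<noteq> 2"
    by (auto dest: arg_cong[where f = nat_of_pnat] simp: nat_of_pnat_one nat_of_pnat_numeral)
  then show ?thesis by blast
qed

definition row :: "offdiag \<Rightarrow> pnat" where "row v = fst (pair_of_offdiag v)"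
definition col :: "offdiag \<Rightarrow> pnat" where "col v = snd (pair_of_offdiag v)"


section \<open>Polynomial rings\<close>

text \<open>The polynomial ring over \<open>'k\<close> with variables indexed by all of \<open>'v\<close>: finitely supported
  functions from exponent vectors to coefficients, with the convolution product of
  \<open>HOL-Library.Poly_Mapping\<close>.\<close>

type_synonym ('v, 'k) mpoly = "('v \<Rightarrow>\<^sub>0 nat) \<Rightarrow>\<^sub>0 'k"

definition Const :: "'k \<Rightarrow> ('v, 'k::comm_ring_1) mpoly" where
  "Const c = Poly_Mapping.single 0 c"

definition Var :: "'v \<Rightarrow> ('v, 'k::comm_ring_1) mpoly" where
  "Var v = Poly_Mapping.single (Poly_Mapping.single v 1) 1"

text \<open>The \<open>'k\<close>-algebra homomorphism that sends each variable \<open>v\<close> to \<open>f v\<close>.\<close>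

definition subst :: "('v \<Rightarrow> ('w, 'k) mpoly) \<Rightarrow> ('v, 'k::comm_ring_1) mpoly \<Rightarrow> ('w, 'k) mpoly" where
  "subst f p = (\<Sum>m\<in>Poly_Mapping.keys p. Const (Poly_Mapping.lookup p m) *
     (\<Prod>v\<in>Poly_Mapping.keys m. f v ^ Poly_Mapping.lookup m v))"

definition vars :: "('v, 'k::comm_ring_1) mpoly \<Rightarrow> 'v set" where
  "vars p = (\<Union>m\<in>Poly_Mapping.keys p. Poly_Mapping.keys m)"

definition total_degree :: "('v, 'k::comm_ring_1) mpoly \<Rightarrow> nat" where
  "total_degree p = Max (insert 0
     ((\<lambda>m. \<Sum>v\<in>Poly_Mapping.keys m. Poly_Mapping.lookup m v) ` Poly_Mapping.keys p))"

text \<open>An ideal is a submodule of the ring regarded as a module over itself.\<close>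

abbreviation ideal_generated :: "'r::comm_ring_1 set \<Rightarrow> 'r set" where
  "ideal_generated \<equiv> module.span (*)"


section \<open>The rings \<open>K[Y]\<close> and \<open>K[X]\<close>\<close>

type_synonym 'k ypoly = "(offdiag, 'k) mpoly"
type_synonym 'k xpoly = "(pnat, 'k) mpoly"

text \<open>\<open>Y i j\<close> is meaningful only for \<open>i \<noteq> j\<close>.\<close>

definition Y :: "pnat \<Rightarrow> pnat \<Rightarrow> 'k::comm_ring_1 ypoly" where
  "Y i j = Var (Abs_offdiag (i, j))"

definition X :: "pnat \<Rightarrow> 'k::comm_ring_1 xpoly" where
  "X i = Var i"

definition perm_act :: "(pnat \<Rightarrow> pnat) \<Rightarrow> 'k ypoly \<Rightarrow> 'k::comm_ring_1 ypoly" where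
  "perm_act \<sigma> = subst (\<lambda>v. Y (\<sigma> (row v)) (\<sigma> (col v)))"

definition orbits :: "'k::comm_ring_1 ypoly set \<Rightarrow> 'k ypoly set" where
  "orbits S = {perm_act \<sigma> f | \<sigma> f. bij \<sigma> \<and> f \<in> S}"

definition equivariant_markov_basis :: "'k::comm_ring_1 ypoly set \<Rightarrow> 'k ypoly set \<Rightarrow> bool" where
  "equivariant_markov_basis S I \<longleftrightarrow> ideal_generated (orbits S) = I"

definition truncation :: "nat \<Rightarrow> 'k::comm_ring_1 ypoly set" where
  "truncation n = {p. \<forall>v\<in>vars p. nat_of_pnat (row v) \<le> n \<and> nat_of_pnat (col v) \<le> n}"

text \<open>The infimum in \<^typ>\<open>enat\<close> is attained unless no \<open>n\<close> qualifies, in which case it is infinite.\<close>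

definition width :: "'k::comm_ring_1 ypoly set \<Rightarrow> enat" where
  "width I = Inf {enat n | n. ideal_generated (orbits (I \<inter> truncation n)) = I}"


section \<open>The monomial map and the binomials\<close>

definition mono_map :: "nat \<Rightarrow> nat \<Rightarrow> 'k ypoly \<Rightarrow> 'k::comm_ring_1 xpoly" where
  "mono_map a b = subst (\<lambda>v. X (row v) ^ a * X (col v) ^ b)"

definition ker_mono_map :: "nat \<Rightarrow> nat \<Rightarrow> 'k::comm_ring_1 ypoly set" where
  "ker_mono_map a b = {p. mono_map a b p = 0}"

definition binomials_i :: "'k::comm_ring_1 ypoly set" where
  "binomials_i = {Y 1 2 * Y 3 4 - Y 1 4 * Y 3 2}"

definition binomials_ii :: "'k::comm_ring_1 ypoly set" where
  "binomials_ii = {Y 1 2 * Y 2 3 * Y 3 1 - Y 2 1 * Y 3 2 * Y 1 3}"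

definition binomial_iii :: "nat \<Rightarrow> nat \<Rightarrow> (pnat \<Rightarrow>\<^sub>0 nat) \<Rightarrow> (pnat \<Rightarrow>\<^sub>0 nat) \<Rightarrow> 'k::comm_ring_1 ypoly" where
  "binomial_iii b n c1 c2 =
     Y 1 2 ^ (b + n) * (\<Prod>j\<in>Poly_Mapping.keys c1 \<union> Poly_Mapping.keys c2.
       Y j 2 ^ Poly_Mapping.lookup c1 j * Y 2 j ^ Poly_Mapping.lookup c2 j)
   - Y 2 1 ^ (b + n) * (\<Prod>j\<in>Poly_Mapping.keys c1 \<union> Poly_Mapping.keys c2.
       Y j 1 ^ Poly_Mapping.lookup c1 j * Y 1 j ^ Poly_Mapping.lookup c2 j)"

text \<open>The families \<open>(c\<^sub>1\<^sub>j)\<close> and \<open>(c\<^sub>2\<^sub>j)\<close> with \<open>j \<ge> 3\<close> are finitely supported functions on all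
  indices whose support avoids 1 and 2.\<close>

definition binomials_iii :: "nat \<Rightarrow> nat \<Rightarrow> 'k::comm_ring_1 ypoly set" where
  "binomials_iii a b = {binomial_iii b n c1 c2 | n c1 c2. n \<le> a - b \<and>
     (\<forall>j \<in> Poly_Mapping.keys c1 \<union> Poly_Mapping.keys c2. 3 \<le> nat_of_pnat j) \<and>
     (\<Sum>j\<in>Poly_Mapping.keys c1. Poly_Mapping.lookup c1 j) = a - b - n \<and>
     (\<Sum>j\<in>Poly_Mapping.keys c2. Poly_Mapping.lookup c2 j) = n}"

definition binomials_iv :: "nat \<Rightarrow> nat \<Rightarrow> 'k::comm_ring_1 ypoly set" where
  "binomials_iv a b =
     {Y 1 2 ^ (b - n) * Y 1 3 ^ n * Y 3 2 ^ (a - b + n)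
      - Y 2 1 ^ (b - n) * Y 2 3 ^ n * Y 3 1 ^ (a - b + n) | n. 1 \<le> n \<and> n \<le> b}"

definition binomials :: "nat \<Rightarrow> nat \<Rightarrow> 'k::comm_ring_1 ypoly set" where
  "binomials a b = binomials_i \<union> binomials_ii \<union> binomials_iii a b \<union> binomials_iv a b"

end

theory Submission
  imports Defs "HOL-Library.Multiset"
begin

text \<open>A monomial of \<open>K[Y]\<close> is a finite directed multigraph without loops: the variable
\<open>y\<^sub>i\<^sub>j\<close> is an edge from \<open>i\<close> to \<open>j\<close>. Its image under \<open>\<pi>\<close> records at each vertex the number
\<open>a * outdegree + b * indegree\<close>, called the weight below. The kernel is spanned by differences of
monomials of equal weight (lemma \<open>ker_subset_ideal_if_binomials\<close>), and the pairs of multigraphs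
whose monomials differ by an element of a fixed ideal form a congruence on the monoid of multigraphs. So the
statement about generators becomes combinatorial: the congruence generated by the moves (i)--(iv)
must relate any two loopless multigraphs of equal weight.

Moves (i) and (ii) keep all degrees and connect all multigraphs with the same degrees: any edge of
the target can be produced inside the source by at most two swaps or one reversal of a triangle,
and then cancelled (\<open>expose_edge\<close>, \<open>same_degrees_imp_congruent\<close>). For weights, coprimality shows
that the outdegrees of two multigraphs \<open>u\<close>, \<open>v\<close> of equal weight differ by multiples of \<open>b\<close> and the
indegrees by the matching negative multiples of \<open>a\<close>. If they differ at all, some vertex \<open>x\<close> has
too large an outdegree and some \<open>y\<close> too small a one. Moves (iii) and (iv) transfer \<open>b\<close> outgoing
edges from \<open>x\<close> to \<open>y\<close> and \<open>a\<close> incoming edges from \<open>y\<close> to \<open>x\<close>, which lowers the difference.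
Such a move is possible after some swaps (lemma \<open>transfer\<close>) because there are at least \<open>a - b\<close>
edges that avoid \<open>x\<close>; this is forced by the mere existence of \<open>v\<close>, in which the edges at \<open>x\<close>
are more numerous by at least \<open>a - b\<close> while the total number of edges is the same.

The moves touch at most \<open>max 4 (a - b + 2)\<close> vertices, and the argument only needs the moves up to
renaming, so it also shows that the truncation of that size generates the kernel. For the reverse
bound take a monomial \<open>U\<close> using more than \<open>n\<close> indices, all of whose proper divisors are alone
in their fibre: no element of the kernel with only \<open>n\<close> indices involves a divisor of \<open>U\<close>, so
\<open>U\<close> occurs in no element of the ideal generated by such elements (\<open>truncation_too_small\<close>). This
applies to \<open>y\<^sub>1\<^sub>2 y\<^sub>3\<^sub>4\<close> and to the case \<open>y\<^sub>1\<^sub>2\<^sup>b y\<^sub>3\<^sub>2 y\<^sub>4\<^sub>2 \<dots>\<close> of (iii): their proper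
divisors have degree less than \<open>a\<close>, too small for a transfer, so the weight determines the degrees,
and since their edges have a common head it determines them.\<close>

section \<open>Directed multigraphs\<close>

definition loopless :: "('v \<times> 'v) multiset \<Rightarrow> bool" where
  "loopless u \<longleftrightarrow> (\<forall>e\<in>#u. fst e \<noteq> snd e)"

definition same_degrees :: "('v \<times> 'v) multiset \<Rightarrow> ('v \<times> 'v) multiset \<Rightarrow> bool" where
  "same_degrees u v \<longleftrightarrow> image_mset fst u = image_mset fst v \<and> image_mset snd u = image_mset snd v"

text \<open>The exponent of the image of a monomial under \<open>\<pi>\<close>, as a multiset of vertices.\<close>

definition weight :: "nat \<Rightarrow> nat \<Rightarrow> ('v \<times> 'v) multiset \<Rightarrow> 'v multiset" where
  "weight a b u = repeat_mset a (image_mset fst u) + repeat_mset b (image_mset snd u)"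

text \<open>Exchanging \<open>x\<close> and \<open>y\<close> in the following two multigraphs gives the two monomials of a binomial of
type (iii) and (iv) respectively. In the first, the sizes of \<open>C\<close> and \<open>D\<close> are \<open>a - b - n\<close> and \<open>n\<close>.\<close>

definition double_star ::
  "nat \<Rightarrow> 'v \<Rightarrow> 'v \<Rightarrow> 'v multiset \<Rightarrow> 'v multiset \<Rightarrow> ('v \<times> 'v) multiset" where
  "double_star b x y C D = replicate_mset (b + size D) (x, y) + image_mset (\<lambda>z. (z, y)) C
     + image_mset (\<lambda>z. (y, z)) D"

definition detour :: "nat \<Rightarrow> nat \<Rightarrow> nat \<Rightarrow> 'v \<Rightarrow> 'v \<Rightarrow> 'v \<Rightarrow> ('v \<times> 'v) multiset" where
  "detour a b n x y z = replicate_mset (b - n) (x, y) + replicate_mset n (x, z)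
     + replicate_mset (a - b + n) (z, y)"

lemma loopless_simps [simp]:
  "loopless {#}"
  "loopless (add_mset e u) \<longleftrightarrow> fst e \<noteq> snd e \<and> loopless u"
  "loopless (u + v) \<longleftrightarrow> loopless u \<and> loopless v"
  by (auto simp: loopless_def)

lemma loopless_double_star:
  "x \<noteq> y \<Longrightarrow> y \<notin># C + D \<Longrightarrow> loopless (double_star b x y C D)"
  by (auto simp: loopless_def double_star_def)

lemma loopless_detour:
  "distinct [x, y, z] \<Longrightarrow> loopless (detour a b n x y z)"
  by (auto simp: loopless_def detour_def)

lemma same_degrees_refl [simp]: "same_degrees u u"
  by (simp add: same_degrees_def)

lemma same_degrees_trans: "same_degrees u v \<Longrightarrow> same_degrees v w \<Longrightarrow> same_degrees u w"
  by (simp add: same_degrees_def)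

lemma edge_leaving: "i \<in># image_mset fst u \<Longrightarrow> \<exists>j. (i, j) \<in># u"
  by force

lemma edge_entering: "j \<in># image_mset snd u \<Longrightarrow> \<exists>i. (i, j) \<in># u"
  by force

lemma size_avoiding_edges:
  "loopless u \<Longrightarrow> size {#e \<in># u. fst e \<noteq> x \<and> snd e \<noteq> x#}
     + count (image_mset fst u) x + count (image_mset snd u) x = size u"
  by (induction u) auto

lemma weight_simps [simp]:
  "weight a b {#} = {#}"
  "weight a b (add_mset e u) = replicate_mset a (fst e) + replicate_mset b (snd e) + weight a b u"
  by (auto simp: weight_def multiset_eq_iff)

lemma size_weight: "size (weight a b u) = (a + b) * size u"
  by (simp add: weight_def algebra_simps)

lemma weight_eq_imp_size_eq: "0 < b \<Longrightarrow> weight a b u = weight a b v \<Longrightarrow> size u = size v"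
  by (metis size_weight add_gr_0 mult_cancel1 neq0_conv)

lemma count_weight:
  "count (weight a b u) i = a * count (image_mset fst u) i + b * count (image_mset snd u) i"
  by (simp add: weight_def)

text \<open>Both exchanges move \<open>b\<close> outgoing edges from \<open>x\<close> to \<open>y\<close> and \<open>a\<close> incoming edges from \<open>y\<close> to
\<open>x\<close>; such a shift changes the weight at \<open>x\<close> by \<open>- a * b + b * a = 0\<close>, and likewise at \<open>y\<close>.\<close>

lemma double_star_degrees:
  assumes "size C + size D = a - b" "b < a"
  shows "image_mset fst (double_star b y x C D) + replicate_mset b x
       = image_mset fst (double_star b x y C D) + replicate_mset b y"
    and "image_mset snd (double_star b y x C D) + replicate_mset a y
       = image_mset snd (double_star b x y C D) + replicate_mset a x"
proof -
  have a: "a = b + size C + size D" using assms by simp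
  show "image_mset fst (double_star b y x C D) + replicate_mset b x
       = image_mset fst (double_star b x y C D) + replicate_mset b y"
    by (simp add: double_star_def multiset.map_comp o_def image_mset_const_eq multiset_eq_iff)
  show "image_mset snd (double_star b y x C D) + replicate_mset a y
       = image_mset snd (double_star b x y C D) + replicate_mset a x"
    by (simp add: a double_star_def multiset.map_comp o_def image_mset_const_eq multiset_eq_iff)
qed

lemma detour_degrees:
  assumes "n \<le> b" "b < a"
  shows "image_mset fst (detour a b n y x z) + replicate_mset b x
       = image_mset fst (detour a b n x y z) + replicate_mset b y"
    and "image_mset snd (detour a b n y x z) + replicate_mset a y
       = image_mset snd (detour a b n x y z) + replicate_mset a x"
  using assms by (auto simp: detour_def multiset_eq_iff)

lemma weight_eq_if_degrees_shifted:
  assumes "image_mset fst u' + replicate_mset b x = image_mset fst u + replicate_mset b y"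
    and "image_mset snd u' + replicate_mset a y = image_mset snd u + replicate_mset a x"
  shows "weight a b u' = weight a b u"
proof (rule multiset_eqI)
  fix i
  have 1: "a * (count (image_mset fst u') i + count (replicate_mset b x) i)
         = a * (count (image_mset fst u) i + count (replicate_mset b y) i)"
    using arg_cong[OF assms(1), of "\<lambda>M. count M i"] by (simp only: count_union)
  have 2: "b * (count (image_mset snd u') i + count (replicate_mset a y) i)
         = b * (count (image_mset snd u) i + count (replicate_mset a x) i)"
    using arg_cong[OF assms(2), of "\<lambda>M. count M i"] by (simp only: count_union)
  show "count (weight a b u') i = count (weight a b u) i"
    using 1 2 unfolding count_weight
    by (auto simp: distrib_left mult.commute split: if_splits)
qed


section \<open>Connecting multigraphs of equal degrees\<close>

locale edge_congruence =
  fixes R :: "('v \<times> 'v) multiset \<Rightarrow> ('v \<times> 'v) multiset \<Rightarrow> bool" (infix "\<approx>" 50)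
  assumes refl: "u \<approx> u"
    and sym: "u \<approx> v \<Longrightarrow> v \<approx> u"
    and trans: "u \<approx> v \<Longrightarrow> v \<approx> w \<Longrightarrow> u \<approx> w"
    and add: "u \<approx> v \<Longrightarrow> u + w \<approx> v + w"
    and swap: "distinct [i, j, k, l] \<Longrightarrow> {#(i, j), (k, l)#} \<approx> {#(i, l), (k, j)#}"
    and triangle: "distinct [i, j, k] \<Longrightarrow> {#(i, j), (j, k), (k, i)#} \<approx> {#(j, i), (k, j), (i, k)#}"
begin

definition reroutes (infix "\<leadsto>" 50) where
  "u \<leadsto> v \<longleftrightarrow> u \<approx> v \<and> loopless v \<and> same_degrees u v"

lemma reroutes_trans: "u \<leadsto> v \<Longrightarrow> v \<leadsto> w \<Longrightarrow> u \<leadsto> w"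
  unfolding reroutes_def using trans same_degrees_trans by blast

text \<open>The equality for \<open>u\<close> lets callers see that other edges of \<open>u\<close> survive the swap.\<close>

lemma swap_edges:
  assumes "loopless u" "(i, j) \<in># u" "(k, l) \<in># u" "distinct [i, j, k, l]"
  obtains w where "u = {#(i, j), (k, l)#} + w" "u \<leadsto> {#(i, l), (k, j)#} + w"
proof -
  obtain v where v: "u = add_mset (i, j) v" using assms(2) by (meson mset_add)
  then have "(k, l) \<in># v" using assms by auto
  then obtain w where w: "v = add_mset (k, l) w" by (meson mset_add)
  have u: "u = {#(i, j), (k, l)#} + w" by (simp add: v w)
  have "u \<leadsto> {#(i, l), (k, j)#} + w"
    unfolding reroutes_def using add[OF swap[OF assms(4)], of w] assms(1,4)
    by (auto simp: u same_degrees_def)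
  with u that show thesis by blast
qed

text \<open>There are edges \<open>i \<rightarrow> k\<close> and \<open>l \<rightarrow> j\<close>, and if \<open>k \<noteq> l\<close> a swap creates \<open>i \<rightarrow> j\<close>. The obstruction is
a single vertex \<open>z = k = l\<close> through which all these edges pass. An edge \<open>x \<rightarrow> y\<close> that avoids \<open>z\<close>
breaks it: swapped with \<open>i \<rightarrow> z\<close> or \<open>z \<rightarrow> j\<close> it brings about the first situation, except when it is
\<open>j \<rightarrow> i\<close>, which closes a triangle.\<close>

lemma expose_edge:
  assumes u: "loopless u" and ij: "i \<noteq> j" "i \<in># image_mset fst u" "j \<in># image_mset snd u"
    and avoid: "\<And>z. z \<noteq> i \<Longrightarrow> z \<noteq> j \<Longrightarrow> \<exists>e\<in>#u. fst e \<noteq> z \<and> snd e \<noteq> z"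
  obtains (exposed) u' where "u \<leadsto> u'" "(i, j) \<in># u'"
proof -
  have direct: thesis
    if uv: "u \<leadsto> v" and ik: "(i, k) \<in># v" and lj: "(l, j) \<in># v"
      and ds: "distinct [i, k, l, j]" for v k l
  proof -
    have "loopless v" using uv by (simp add: reroutes_def)
    then obtain w where "v \<leadsto> {#(i, j), (l, k)#} + w"
      using swap_edges[OF _ ik lj ds] by metis
    from reroutes_trans[OF uv this] show thesis by (rule exposed) simp
  qed
  have uu: "u \<leadsto> u" using u refl by (simp add: reroutes_def)
  have nl: "p \<noteq> q" if "(p, q) \<in># u" for p q using u that by (auto simp: loopless_def)
  obtain k l where k: "(i, k) \<in># u" and l: "(l, j) \<in># u"
    using edge_leaving[OF ij(2)] edge_entering[OF ij(3)] by blast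
  consider "(i, j) \<in># u" | "(i, j) \<notin># u" "k \<noteq> l" | "(i, j) \<notin># u" "k = l" by blast
  then show thesis
  proof cases
    case 1
    then show thesis using exposed uu by blast
  next
    case 2
    then show thesis using direct[OF uu k l] nl[OF k] nl[OF l] k l ij by auto
  next
    case 3
    define z where "z = k"
    have iz: "(i, z) \<in># u" and zj: "(z, j) \<in># u" using k l 3 by (auto simp: z_def)
    have z: "z \<noteq> i" "z \<noteq> j" using nl iz zj by auto
    obtain x y where xy: "(x, y) \<in># u" "x \<noteq> z" "y \<noteq> z" using avoid[OF z] by force
    have "x \<noteq> y" using nl xy by auto
    consider "x = i" | "y = j" | "x = j" "y = i" | "x \<noteq> i" "y \<noteq> i" "y \<noteq> j"
      | "x \<noteq> i" "x \<noteq> j" "y = i" using \<open>x \<noteq> y\<close> by blast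
    then show thesis
    proof cases
      case 1
      then show thesis using direct[OF uu _ zj, of y] xy \<open>x \<noteq> y\<close> 3 z ij by auto
    next
      case 2
      then show thesis using direct[OF uu iz, of x] xy \<open>x \<noteq> y\<close> 3 z ij by auto
    next
      case c: 3
      obtain w where w: "u = {#(i, z), (z, j), (j, i)#} + w"
      proof -
        have "{#(i, z), (z, j), (j, i)#} \<subseteq># u"
          using iz zj xy c z ij by (simp add: insert_subset_eq_iff in_diff_count)
        then show thesis using that by (metis subset_mset.add_diff_inverse)
      qed
      have "u \<leadsto> {#(z, i), (j, z), (i, j)#} + w"
        unfolding reroutes_def using add[OF triangle[of i z j], of w] u z ij
        by (auto simp: w same_degrees_def)
      then show thesis by (rule exposed) simp
    next
      case 4
      obtain w where w: "u = {#(i, z), (x, y)#} + w" "u \<leadsto> {#(i, y), (x, z)#} + w"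
        using swap_edges[OF u iz xy(1)] 4 z xy \<open>x \<noteq> y\<close> by auto
      have "(z, j) \<in># w" using zj w z xy by auto
      then show thesis using direct[OF w(2), of y z] 4 z xy ij by auto
    next
      case 5
      obtain w where w: "u = {#(z, j), (x, i)#} + w" "u \<leadsto> {#(z, i), (x, j)#} + w"
        using swap_edges[OF u zj, of x i] 5 z xy ij by auto
      have "(i, z) \<in># w" using iz w z xy ij 5 by auto
      then show thesis using direct[OF w(2), of z x] 5 z xy ij by auto
    qed
  qed
qed

text \<open>By induction on \<open>v\<close>, an edge of \<open>v\<close> is exposed in \<open>u\<close> and removed from both. The hypothesis of
\<open>expose_edge\<close> on avoiding \<open>z\<close> depends only on the degrees, because a loopless multigraph has
\<open>size - outdegree - indegree\<close> edges away from \<open>z\<close>; it holds in \<open>v\<close>, which has the edge itself.\<close>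

theorem same_degrees_imp_congruent:
  assumes "loopless u" "loopless v" "same_degrees u v"
  shows "u \<approx> v"
  using assms
proof (induction v arbitrary: u)
  case empty
  then show ?case using refl by (simp add: same_degrees_def)
next
  case (add e v)
  obtain i j where e: "e = (i, j)" by force
  have ij: "i \<noteq> j" using add.prems(2) e by simp
  have deg: "image_mset fst u = add_mset i (image_mset fst v)"
    "image_mset snd u = add_mset j (image_mset snd v)"
    using add.prems(3) by (auto simp: same_degrees_def e)
  have avoid: "\<exists>e\<in>#u. fst e \<noteq> z \<and> snd e \<noteq> z" if "z \<noteq> i" "z \<noteq> j" for z
  proof -
    have "size u = Suc (size v)" using arg_cong[OF deg(1), of size] by simp
    moreover have "count (image_mset fst v) z + count (image_mset snd v) z \<le> size v"
      using size_avoiding_edges[of v z] add.prems(2) by simp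
    ultimately have "0 < size {#e \<in># u. fst e \<noteq> z \<and> snd e \<noteq> z#}"
      using size_avoiding_edges[OF add.prems(1), of z] that by (simp add: deg)
    then show ?thesis by (auto simp: nonempty_has_size[symmetric] filter_mset_eq_conv)
  qed
  obtain u' where u': "u \<leadsto> u'" "(i, j) \<in># u'"
    using expose_edge[OF add.prems(1) ij _ _ avoid] deg by auto
  obtain w where w: "u' = add_mset (i, j) w" using u'(2) by (meson mset_add)
  have "w \<approx> v"
    using u'(1) add.prems by (intro add.IH) (auto simp: reroutes_def w e same_degrees_def)
  from edge_congruence.add[OF edge_congruence_axioms this, of "{#(i, j)#}"]
  have "u' \<approx> add_mset e v" by (simp add: w e)
  with u'(1) show ?case using trans by (auto simp: reroutes_def)
qed

end


text \<open>All solutions of \<open>a * m + b * n = const\<close> arise from one by adding multiples of \<open>(b, - a)\<close>.\<close>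

lemma coprime_combination_shift:
  fixes a b m n m' n' :: nat
  assumes "a * m + b * n = a * m' + b * n'" "m' < m" "coprime a b" "0 < a" "0 < b"
  obtains s where "0 < s" "m = m' + b * s" "n' = n + a * s"
proof -
  obtain d where d: "m = m' + d" "0 < d" using assms(2) less_imp_add_positive by blast
  have "n < n'" 
  proof (rule ccontr)
    assume "\<not> n < n'"
    then have "b * n' \<le> b * n" by simp
    moreover have "0 < a * d" using assms(4) d by simp
    moreover have "a * m = a * m' + a * d" by (simp add: d distrib_left)
    ultimately show False using assms(1) by linarith
  qed
  then obtain e where e: "n' = n + e" using less_imp_add_positive by blast
  have eq: "a * d = b * e" using assms(1) by (simp add: d e algebra_simps)
  then have "b dvd d" using assms(3) by (metis coprime_commute coprime_dvd_mult_right_iff dvd_triv_left)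
  then obtain s where s: "d = b * s" by blast
  have "e = a * s" using eq s assms(5) by simp
  then show thesis using that[of s] d e s by auto
qed

lemma exists_submultiset_of_size:
  assumes "k \<le> size M"
  obtains N where "N \<subseteq># M" "size N = k"
proof -
  obtain xs where xs: "M = mset xs" by (metis ex_mset)
  have "mset (take k xs) \<subseteq># M"
    unfolding xs by (metis append_take_drop_id mset_append mset_subset_eq_add_left)
  with assms xs that show thesis by simp
qed

lemma add_middle: "(A :: 'c multiset) + r = B + s \<Longrightarrow> A + W + r = B + W + s"
  by (metis union_assoc union_commute)


section \<open>Connecting multigraphs of equal weight\<close>

locale weight_congruence = edge_congruence R
  for R :: "('v \<times> 'v) multiset \<Rightarrow> ('v \<times> 'v) multiset \<Rightarrow> bool" (infix "\<approx>" 50) +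
  fixes a b :: nat
  assumes b_pos: "0 < b" and b_less_a: "b < a"
    and star_move: "x \<noteq> y \<Longrightarrow> x \<notin># C + D \<Longrightarrow> y \<notin># C + D \<Longrightarrow> size C + size D = a - b \<Longrightarrow>
      double_star b x y C D \<approx> double_star b y x C D"
    and detour_move: "distinct [x, y, z] \<Longrightarrow> 1 \<le> n \<Longrightarrow> n \<le> b \<Longrightarrow>
      detour a b n x y z \<approx> detour a b n y x z"
begin

text \<open>The effect that (iii) and (iv) have on the degrees, for arbitrary multigraphs in one class.\<close>

definition transfers where
  "transfers x y u u' \<longleftrightarrow> u \<approx> u' \<and> loopless u' \<and>
     image_mset fst u' + replicate_mset b x = image_mset fst u + replicate_mset b y \<and>
     image_mset snd u' + replicate_mset a y = image_mset snd u + replicate_mset a x"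

lemma reroutes_then_transfers: "u \<leadsto> v \<Longrightarrow> transfers x y v u' \<Longrightarrow> transfers x y u u'"
  unfolding transfers_def reroutes_def same_degrees_def using trans by auto

lemma transfers_by_double_star:
  assumes "loopless u" "x \<noteq> y" "x \<notin># C + D" "y \<notin># C + D" "size C + size D = a - b"
    and "double_star b x y C D \<subseteq># u"
  shows "\<exists>u'. transfers x y u u'"
proof -
  obtain w where w: "u = double_star b x y C D + w"
    using assms(6) by (metis subset_mset.add_diff_inverse)
  have "transfers x y u (double_star b y x C D + w)"
    unfolding transfers_def
    using add[OF star_move[of x y C D], of w] assms(1-5) loopless_double_star[of y x C D b]
      add_middle[OF double_star_degrees(1)[OF assms(5) b_less_a, of y x], of "image_mset fst w"]
      add_middle[OF double_star_degrees(2)[OF assms(5) b_less_a, of y x], of "image_mset snd w"]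
    by (simp add: w)
  then show ?thesis ..
qed

lemma transfers_by_detour:
  assumes "loopless u" "distinct [x, y, z]" "1 \<le> n" "n \<le> b" "detour a b n x y z \<subseteq># u"
  shows "\<exists>u'. transfers x y u u'"
proof -
  obtain w where w: "u = detour a b n x y z + w"
    using assms(5) by (metis subset_mset.add_diff_inverse)
  have "distinct [y, x, z]" using assms(2) by auto
  then have "transfers x y u (detour a b n y x z + w)"
    unfolding transfers_def
    using add[OF detour_move[of x y z n], of w] assms(1-4) loopless_detour[of y x z a b n]
      add_middle[OF detour_degrees(1)[OF assms(4) b_less_a, of y x z], of "image_mset fst w"]
      add_middle[OF detour_degrees(2)[OF assms(4) b_less_a, of y x z], of "image_mset snd w"]
    by (simp add: w)
  then show ?thesis ..
qed

text \<open>Every edge that avoids \<open>x\<close> enters \<open>y\<close> (\<open>G\<close>), leaves \<open>y\<close> (\<open>F\<close>) or is disjoint from \<open>{x, y}\<close>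
(\<open>E\<close>). If \<open>F\<close> and \<open>G\<close> together contain \<open>a - b\<close> edges, using as many from \<open>G\<close> as possible, there
is a move of type (iii). Otherwise an edge of \<open>E\<close> is swapped with an edge from \<open>x\<close> to \<open>y\<close>,
which enlarges \<open>G\<close>. This keeps \<open>b\<close> parallel edges: as long as \<open>G\<close> has fewer than \<open>a - b\<close>
elements, the indegree of \<open>y\<close>, at least \<open>a\<close>, forces more than \<open>b\<close> of them.\<close>

lemma transfer_along_many_parallel_edges:
  assumes "loopless u" "x \<noteq> y" "b \<le> count u (x, y)" "a \<le> count (image_mset snd u) y"
    and "a - b \<le> size {#e \<in># u. fst e \<noteq> x \<and> snd e \<noteq> x#}"
  shows "\<exists>u'. transfers x y u u'"
  using assms
proof (induction "count u (x, y)" arbitrary: u rule: less_induct)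
  case less
  note u = less.prems(1) and xy = less.prems(2)
  define p where "p = count u (x, y)"
  define G where "G = {#e \<in># u. snd e = y \<and> fst e \<noteq> x#}"
  define F where "F = {#e \<in># u. fst e = y \<and> snd e \<noteq> x#}"
  define E where "E = {#e \<in># u. {fst e, snd e} \<inter> {x, y} = {}#}"
  have no_loop: "count u (z, z) = 0" for z
    using u by (auto simp: loopless_def not_in_iff[symmetric])
  have in_y: "count (image_mset snd u) y = p + size G"
    unfolding p_def G_def by (induction u) auto
  have sizes: "size {#e \<in># u. fst e \<noteq> x \<and> snd e \<noteq> x#} = size E + size F + size G"
    using u unfolding E_def F_def G_def by (induction u) (use xy in auto)
  have sub: "replicate_mset p (x, y) + G + F \<subseteq># u"
    using no_loop xy by (intro mset_subset_eqI) (auto simp: p_def G_def F_def)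
  have star: ?case
    if G0: "G0 \<subseteq># G" and F0: "F0 \<subseteq># F" and sz: "size G0 + size F0 = a - b" "b + size F0 \<le> p" for G0 F0
  proof (rule transfers_by_double_star)
    have mem: "fst e \<noteq> x \<and> fst e \<noteq> y \<and> snd e = y" if "e \<in># G0" for e
      using mset_subset_eqD[OF G0 that] u by (auto simp: G_def loopless_def)
    have mem': "snd e \<noteq> x \<and> snd e \<noteq> y \<and> fst e = y" if "e \<in># F0" for e
      using mset_subset_eqD[OF F0 that] u by (auto simp: F_def loopless_def)
    show "x \<notin># image_mset fst G0 + image_mset snd F0" "y \<notin># image_mset fst G0 + image_mset snd F0"
      using mem mem' by auto
    have "image_mset (\<lambda>z. (z, y)) (image_mset fst G0) = image_mset (\<lambda>e. e) G0"
      unfolding multiset.map_comp o_def using mem by (intro image_mset_cong) (auto simp: prod_eq_iff)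
    moreover have "image_mset (\<lambda>z. (y, z)) (image_mset snd F0) = image_mset (\<lambda>e. e) F0"
      unfolding multiset.map_comp o_def using mem' by (intro image_mset_cong) (auto simp: prod_eq_iff)
    ultimately have "double_star b x y (image_mset fst G0) (image_mset snd F0)
        = replicate_mset (b + size F0) (x, y) + G0 + F0"
      by (simp add: double_star_def)
    also have "\<dots> \<subseteq># replicate_mset p (x, y) + G + F"
      using sz(2) G0 F0 by (intro mset_subset_eq_mono_add) (simp_all add: replicate_mset_msubseteq_iff)
    finally show "double_star b x y (image_mset fst G0) (image_mset snd F0) \<subseteq># u"
      using sub by (rule subset_mset.order_trans)
  qed (use u xy sz in auto)
  consider "a - b \<le> size G" | "size G < a - b" "a - b \<le> size G + size F"
    | "size G < a - b" "0 < size E"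
    using less.prems(5) sizes by linarith
  then show ?case
  proof cases
    case 1
    then obtain G0 where "G0 \<subseteq># G" "size G0 = a - b" using exists_submultiset_of_size by metis
    then show ?thesis using star[of G0 "{#}"] less.prems(3) by (simp add: p_def)
  next
    case 2
    then obtain F0 where "F0 \<subseteq># F" "size F0 = a - b - size G"
      using exists_submultiset_of_size[of "a - b - size G" F] by force
    then show ?thesis using star[of G F0] less.prems(4) in_y 2 by simp
  next
    case 3
    then obtain k l where kl: "(k, l) \<in># E" by (metis nonempty_has_size multiset_nonemptyE surj_pair)
    then have kl: "(k, l) \<in># u" "distinct [x, y, k, l]"
      using u xy by (auto simp: E_def loopless_def)
    have "(x, y) \<in># u" by (rule count_inI) (use less.prems(3) b_pos in simp)
    then obtain w where w: "u = {#(x, y), (k, l)#} + w" "u \<leadsto> {#(x, l), (k, y)#} + w"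
      using swap_edges[OF u _ kl] by metis
    have "b < p" using 3 in_y less.prems(4) b_less_a by linarith
    have "\<exists>u'. transfers x y ({#(x, l), (k, y)#} + w) u'"
    proof (rule less.hyps)
      have "count u (x, y) = Suc (count ({#(x, l), (k, y)#} + w) (x, y))"
        using kl(2) by (auto simp: w(1))
      then show "count ({#(x, l), (k, y)#} + w) (x, y) < count u (x, y)"
        "b \<le> count ({#(x, l), (k, y)#} + w) (x, y)" using \<open>b < p\<close> by (auto simp: p_def)
      show "a - b \<le> size {#e \<in># {#(x, l), (k, y)#} + w. fst e \<noteq> x \<and> snd e \<noteq> x#}"
        using less.prems(5) kl(2) by (auto simp: w(1))
      show "a \<le> count (image_mset snd ({#(x, l), (k, y)#} + w)) y"
        using less.prems(4) kl(2) by (auto simp: w(1))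
    qed (use xy w(2) in \<open>auto simp: reroutes_def\<close>)
    then show ?thesis using reroutes_then_transfers[OF w(2)] by blast
  qed
qed

text \<open>The case of at least \<open>b\<close> edges from \<open>x\<close> to \<open>y\<close> is the previous lemma; the hypothesis on the size says
that \<open>a - b\<close> edges avoid \<open>x\<close>. With fewer than \<open>b\<close> edges from \<open>x\<close> to \<open>y\<close> there are edges \<open>x \<rightarrow> k\<close> and \<open>l \<rightarrow> y\<close> with
\<open>k \<noteq> y\<close> and \<open>l \<noteq> x\<close>, and a swap yields one more edge \<open>x \<rightarrow> y\<close>, unless all of these pass through
a single vertex \<open>z\<close>. In that case the degrees are large enough for a move of type (iv).\<close>

lemma transfer:
  assumes "loopless u" "x \<noteq> y" "b \<le> count (image_mset fst u) x" "a \<le> count (image_mset snd u) y"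
    and "count (image_mset fst u) x + count (image_mset snd u) x + (a - b) \<le> size u"
  shows "\<exists>u'. transfers x y u u'"
  using assms
proof (induction "b - count u (x, y)" arbitrary: u rule: less_induct)
  case less
  note u = less.prems(1) and xy = less.prems(2)
  define p where "p = count u (x, y)"
  show ?case
  proof (cases "b \<le> p")
    case True
    then show ?thesis
      using transfer_along_many_parallel_edges[OF u xy] less.prems(4,5) size_avoiding_edges[OF u, of x]
      by (simp add: p_def)
  next
    case False
    have out_x: "count (image_mset fst u) x = p + size {#e \<in># u. fst e = x \<and> snd e \<noteq> y#}"
      unfolding p_def by (induction u) auto
    have in_y: "count (image_mset snd u) y = p + size {#e \<in># u. snd e = y \<and> fst e \<noteq> x#}"
      unfolding p_def by (induction u) auto
    have "0 < size {#e \<in># u. fst e = x \<and> snd e \<noteq> y#}"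
      using out_x False less.prems(3) by linarith
    then obtain e where "e \<in># {#e \<in># u. fst e = x \<and> snd e \<noteq> y#}"
      by (metis nonempty_has_size multiset_nonemptyE)
    then obtain z where z: "(x, z) \<in># u" "z \<noteq> y" by (cases e) auto
    have "0 < size {#e \<in># u. snd e = y \<and> fst e \<noteq> x#}"
      using in_y False less.prems(4) b_less_a by linarith
    then obtain f where "f \<in># {#e \<in># u. snd e = y \<and> fst e \<noteq> x#}"
      by (metis nonempty_has_size multiset_nonemptyE)
    then obtain l where l: "(l, y) \<in># u" "l \<noteq> x" by (cases f) auto
    have nl: "i \<noteq> j" if "(i, j) \<in># u" for i j using u that by (auto simp: loopless_def)
    show ?thesis
    proof (cases "\<exists>k l. (x, k) \<in># u \<and> k \<noteq> y \<and> (l, y) \<in># u \<and> l \<noteq> x \<and> k \<noteq> l")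
      case True
      then obtain k l where kl: "(x, k) \<in># u" "(l, y) \<in># u" "distinct [x, k, l, y]"
        using nl xy by force
      then obtain w where w: "u = {#(x, k), (l, y)#} + w" "u \<leadsto> {#(x, y), (l, k)#} + w"
        using swap_edges[OF u] by metis
      define v where "v = {#(x, y), (l, k)#} + w"
      have v: "loopless v" "image_mset fst v = image_mset fst u" "image_mset snd v = image_mset snd u"
        "size v = size u"
        using w(2) unfolding v_def[symmetric]
        by (auto simp: reroutes_def same_degrees_def w(1)) (simp add: v_def)
      have "count v (x, y) = Suc p"
        using kl(3) by (auto simp: w(1) p_def v_def)
      then have "b - count v (x, y) < b - count u (x, y)"
        using False by (simp add: p_def)
      then have "\<exists>u'. transfers x y v u'"
        by (rule less.hyps) (use v xy less.prems in \<open>simp_all only: v\<close>)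
      then show ?thesis using reroutes_then_transfers[OF w(2)] unfolding v_def by blast
    next
      case bottleneck: False
      have "l = z" using bottleneck z l by blast
      have zd: "distinct [x, y, z]" using nl z l xy by auto
      have "\<forall>e\<in>#u. fst e = x \<longrightarrow> snd e = y \<or> snd e = z" using bottleneck l \<open>l = z\<close> by force
      then have xz: "count (image_mset fst u) x = p + count u (x, z)"
        unfolding p_def by (induction u) (use zd in auto)
      have "\<forall>e\<in>#u. snd e = y \<longrightarrow> fst e = x \<or> fst e = z" using bottleneck z by force
      then have zy: "count (image_mset snd u) y = p + count u (z, y)"
        unfolding p_def by (induction u) (use zd in auto)
      have "detour a b (b - p) x y z \<subseteq># u"
        using zd False xz zy less.prems(3,4) b_less_a
        by (intro mset_subset_eqI) (auto simp: detour_def p_def)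
      then show ?thesis using False by (intro transfers_by_detour[OF u zd, of "b - p"]) auto
    qed
  qed
qed

text \<open>The measure is the total excess of the outdegrees of \<open>u\<close> over those of \<open>v\<close>; a transfer from a
vertex with excess to one with deficit lowers it by \<open>b\<close>.\<close>

theorem weight_eq_imp_congruent:
  assumes "coprime a b" "loopless u" "loopless v" "weight a b u = weight a b v"
  shows "u \<approx> v"
  using assms(2,4)
proof (induction "size (image_mset fst u - image_mset fst v)" arbitrary: u rule: less_induct)
  case less
  have sz: "size u = size v" using weight_eq_imp_size_eq[OF b_pos less.prems(2)] .
  have eq: "a * count (image_mset fst u) i + b * count (image_mset snd u) i
     = a * count (image_mset fst v) i + b * count (image_mset snd v) i" for i
    using arg_cong[OF less.prems(2), of "\<lambda>M. count M i"] by (simp add: count_weight)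
  show ?case
  proof (cases "image_mset fst u = image_mset fst v")
    case True
    then have "image_mset snd u = image_mset snd v"
      using eq b_pos by (intro multiset_eqI) simp
    with True show ?thesis
      using same_degrees_imp_congruent less.prems(1) assms(3) by (simp add: same_degrees_def)
  next
    case False
    have exceeds: "\<exists>i. count N i < count M i" if "M \<noteq> N" "size M = size N" for M N :: "'v multiset"
      using that by (metis mset_subset_eqI mset_subset_size not_le subset_mset.le_neq_trans less_irrefl)
    obtain x where x: "count (image_mset fst v) x < count (image_mset fst u) x"
      using exceeds[of "image_mset fst u" "image_mset fst v"] False sz by auto
    obtain y where y: "count (image_mset fst u) y < count (image_mset fst v) y"
      using exceeds[of "image_mset fst v" "image_mset fst u"] False sz by auto
    have a_pos: "0 < a" using b_less_a by simp
    obtain s where s: "0 < s" "count (image_mset fst u) x = count (image_mset fst v) x + b * s"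
        "count (image_mset snd v) x = count (image_mset snd u) x + a * s"
      using coprime_combination_shift[OF eq x assms(1) a_pos b_pos] .
    obtain t where t: "0 < t" "count (image_mset fst v) y = count (image_mset fst u) y + b * t"
        "count (image_mset snd u) y = count (image_mset snd v) y + a * t"
      using coprime_combination_shift[OF eq[symmetric] y assms(1) a_pos b_pos] .
    have "b \<le> b * s" "a \<le> a * t" "b \<le> b * t" using s(1) t(1) by auto
    \<comment> \<open>\<open>v\<close> has \<open>(a - b) * s\<close> more edges at \<open>x\<close> than \<open>u\<close>, and \<open>v\<close> is no larger than \<open>u\<close>.\<close>
    have "b * s + (a - b) \<le> a * s"
    proof -
      obtain c where c: "a = b + c" using b_less_a less_imp_add_positive by blast
      show ?thesis using s(1) by (simp add: c algebra_simps)
    qed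
    then have room: "count (image_mset fst u) x + count (image_mset snd u) x + (a - b) \<le> size u"
      using size_avoiding_edges[OF assms(3), of x] s sz by linarith
    have gap: "count (image_mset fst v) x + b \<le> count (image_mset fst u) x"
        "count (image_mset fst u) y + b \<le> count (image_mset fst v) y"
      using s(2) t(2) \<open>b \<le> b * s\<close> \<open>b \<le> b * t\<close> by linarith+
    have "x \<noteq> y" using x y by auto
    moreover have "b \<le> count (image_mset fst u) x" using s(2) \<open>b \<le> b * s\<close> by linarith
    moreover have "a \<le> count (image_mset snd u) y" using t(3) \<open>a \<le> a * t\<close> by linarith
    ultimately obtain u' where u': "transfers x y u u'"
      using transfer[OF less.prems(1)] room by metis
    have fst: "image_mset fst u' + replicate_mset b x = image_mset fst u + replicate_mset b y"
      using u' by (simp add: transfers_def)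
    have cnt: "count (image_mset fst u') i + (if i = x then b else 0)
      = count (image_mset fst u) i + (if i = y then b else 0)" for i
      using arg_cong[OF fst, of "\<lambda>M. count M i"] by (simp split: if_splits)
    have "image_mset fst u - image_mset fst v = (image_mset fst u' - image_mset fst v) + replicate_mset b x"
    proof (rule multiset_eqI)
      fix i
      show "count (image_mset fst u - image_mset fst v) i
        = count (image_mset fst u' - image_mset fst v + replicate_mset b x) i"
        using cnt[of i] gap by (auto split: if_splits)
    qed
    then have "size (image_mset fst u' - image_mset fst v) < size (image_mset fst u - image_mset fst v)"
      using b_pos by simp
    moreover have "weight a b u' = weight a b v"
      using weight_eq_if_degrees_shifted[of u' b x u y a] u' less.prems(2) by (simp add: transfers_def)
    ultimately have "u' \<approx> v" using u' by (intro less.hyps) (simp_all add: transfers_def)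
    then show ?thesis using u' trans by (auto simp: transfers_def)
  qed
qed

end


section \<open>Monomials as multisets\<close>

text \<open>Exponent vectors are translated into multisets of variables, so that the combinatorial results
apply and products over a monomial become products over a multiset.\<close>

definition expo :: "'v multiset \<Rightarrow> 'v \<Rightarrow>\<^sub>0 nat" where
  "expo M = (\<Sum>v\<in>#M. Poly_Mapping.single v 1)"

definition mset_of :: "('v \<Rightarrow>\<^sub>0 nat) \<Rightarrow> 'v multiset" where
  "mset_of m = Abs_multiset (Poly_Mapping.lookup m)"

lemma lookup_expo [simp]: "Poly_Mapping.lookup (expo M) v = count M v"
  by (induction M) (auto simp: expo_def lookup_add lookup_single when_def)

lemma count_mset_of [simp]: "count (mset_of m) v = Poly_Mapping.lookup m v"
proof -
  have "finite {v. 0 < Poly_Mapping.lookup m v}"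
    using finite_keys[of m] by (simp add: keys.rep_eq)
  then show ?thesis by (simp add: mset_of_def Abs_multiset_inverse)
qed

lemma expo_mset_of [simp]: "expo (mset_of m) = m"
  by (rule poly_mapping_eqI) simp

lemma mset_of_expo [simp]: "mset_of (expo M) = M"
  by (rule multiset_eqI) simp

lemma expo_inject [simp]: "expo M = expo N \<longleftrightarrow> M = N"
  by (metis mset_of_expo)

lemma expo_simps [simp]:
  "expo {#} = 0" "expo (M + N) = expo M + expo N"
  by (simp_all add: expo_def)

lemma mset_of_add [simp]: "mset_of (m + n) = mset_of m + mset_of n"
  by (rule multiset_eqI) (simp add: lookup_add)

lemma keys_expo [simp]: "Poly_Mapping.keys (expo M) = set_mset M"
  by (auto simp: in_keys_iff)

lemma set_mset_of [simp]: "set_mset (mset_of m) = Poly_Mapping.keys m"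
  by (metis expo_mset_of keys_expo)

lemma size_mset_of: "size (mset_of m) = (\<Sum>v\<in>Poly_Mapping.keys m. Poly_Mapping.lookup m v)"
  by (simp add: size_multiset_overloaded_eq)

lemma prod_mset_mset_of:
  "(\<Prod>v\<in>#mset_of m. f v) = (\<Prod>v\<in>Poly_Mapping.keys m. f v ^ Poly_Mapping.lookup m v)"
  by (simp add: image_prod_mset_multiplicity)

lemma prod_mset_Var:
  "(\<Prod>v\<in>#M. Var v :: ('v, 'k::comm_ring_1) mpoly) = Poly_Mapping.single (expo M) 1"
  by (induction M) (simp_all add: Var_def mult_single expo_def)


section \<open>Linear maps and substitutions\<close>

lemma Const_simps [simp]:
  "Const 0 = 0" "Const 1 = 1" "Const (c + d) = Const c + Const d" "Const (c * d) = Const c * Const d"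
  by (simp_all add: Const_def single_add mult_single)

lemma Const_mult_single: "Const c * Poly_Mapping.single m d = Poly_Mapping.single m (c * d)"
  by (simp add: Const_def mult_single)

lemma mpoly_expansion:
  "p = (\<Sum>m\<in>Poly_Mapping.keys p. Poly_Mapping.single m (Poly_Mapping.lookup p m))"
proof (rule poly_mapping_eqI)
  fix m
  have "Poly_Mapping.lookup (\<Sum>n\<in>Poly_Mapping.keys p. Poly_Mapping.single n (Poly_Mapping.lookup p n)) m
    = (\<Sum>n\<in>Poly_Mapping.keys p. if n = m then Poly_Mapping.lookup p n else 0)"
    by (simp add: lookup_sum lookup_single when_def)
  also have "\<dots> = Poly_Mapping.lookup p m" by (simp add: in_keys_iff)
  finally show "Poly_Mapping.lookup p m = Poly_Mapping.lookup
    (\<Sum>n\<in>Poly_Mapping.keys p. Poly_Mapping.single n (Poly_Mapping.lookup p n)) m" ..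
qed

lemma mpoly_induct [case_names zero single add]:
  fixes p :: "('v, 'k::comm_ring_1) mpoly"
  assumes "P 0" "\<And>M c. P (Poly_Mapping.single (expo M) c)" "\<And>p q. P p \<Longrightarrow> P q \<Longrightarrow> P (p + q)"
  shows "P p"
proof -
  have "P (\<Sum>m\<in>A. Poly_Mapping.single m (Poly_Mapping.lookup p m))" if "finite A" for A
    using that assms by (induction A) (auto, metis expo_mset_of)
  from this[OF finite_keys, of p] show ?thesis by (simp add: mpoly_expansion[symmetric])
qed

text \<open>Substitutions are a special case, but \<open>lin\<close> also covers maps that are only linear, such as a
choice of one monomial in each fibre of \<open>\<pi>\<close>.\<close>

definition lin :: "(('v \<Rightarrow>\<^sub>0 nat) \<Rightarrow> ('w, 'k) mpoly) \<Rightarrow> ('v, 'k::comm_ring_1) mpoly \<Rightarrow> ('w, 'k) mpoly" where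
  "lin g p = (\<Sum>m\<in>Poly_Mapping.keys p. Const (Poly_Mapping.lookup p m) * g m)"

lemma lin_superset:
  assumes "finite A" "Poly_Mapping.keys p \<subseteq> A"
  shows "lin g p = (\<Sum>m\<in>A. Const (Poly_Mapping.lookup p m) * g m)"
  unfolding lin_def using assms by (intro sum.mono_neutral_left) (auto simp: in_keys_iff)

lemma lin_zero [simp]: "lin g 0 = 0"
  by (simp add: lin_def)

lemma lin_add [simp]: "lin g (p + q) = lin g p + lin g q"
proof -
  let ?A = "Poly_Mapping.keys p \<union> Poly_Mapping.keys q"
  have "Poly_Mapping.keys (p + q) \<subseteq> ?A" by (rule Poly_Mapping.keys_add)
  then show ?thesis
    by (simp add: lin_superset[of ?A] lookup_add distrib_right sum.distrib)
qed

lemma lin_diff [simp]: "lin g (p - q) = lin g p - lin g q"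
  using lin_add[of g "p - q" q] by simp

lemma lin_single [simp]: "lin g (Poly_Mapping.single m c) = Const c * g m"
  by (subst lin_superset[of "{m}"]) auto

lemma lin_Const_mult [simp]: "lin g (Const c * p) = Const c * lin g p"
proof (induction p rule: mpoly_induct)
  case (single M d)
  then show ?case by (simp add: Const_mult_single mult.assoc[symmetric])
qed (simp_all add: distrib_left)

lemma subst_eq_lin: "subst f = lin (\<lambda>m. \<Prod>v\<in>#mset_of m. f v)"
  by (simp add: fun_eq_iff subst_def lin_def prod_mset_mset_of)

lemma subst_mult: "subst f (p * q) = subst f p * subst f q"
proof (induction p rule: mpoly_induct)
  case (single M c)
  show ?case
  proof (induction q rule: mpoly_induct)
    case (single N d)
    show ?case by (simp add: subst_eq_lin mult_single ac_simps)
  qed (simp_all add: subst_eq_lin distrib_left)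
qed (simp_all add: subst_eq_lin distrib_right)

interpretation ideal: module "(*) :: 'r::comm_ring_1 \<Rightarrow> 'r \<Rightarrow> 'r"
  by unfold_locales (simp_all add: algebra_simps)


section \<open>Monomials of multigraphs\<close>

definition edge_monomial :: "(pnat \<times> pnat) multiset \<Rightarrow> 'k::comm_ring_1 ypoly" where
  "edge_monomial U = (\<Prod>e\<in>#U. Y (fst e) (snd e))"

definition edges :: "(offdiag \<Rightarrow>\<^sub>0 nat) \<Rightarrow> (pnat \<times> pnat) multiset" where
  "edges m = image_mset pair_of_offdiag (mset_of m)"

lemma pair_of_Abs_offdiag: "fst e \<noteq> snd e \<Longrightarrow> pair_of_offdiag (Abs_offdiag e) = e"
  by (rule Abs_offdiag_inverse) (auto simp: case_prod_beta)

lemma loopless_edges: "loopless (edges m)"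
  using pair_of_offdiag by (auto simp: loopless_def edges_def case_prod_beta)

lemma edge_monomial_eq_single:
  "edge_monomial U = Poly_Mapping.single (expo (image_mset Abs_offdiag U)) 1"
  unfolding prod_mset_Var[symmetric] edge_monomial_def Y_def by (simp add: multiset.map_comp o_def)

lemma edge_monomial_edges: "edge_monomial (edges m) = Poly_Mapping.single m 1"
  by (simp add: edge_monomial_eq_single edges_def multiset.map_comp o_def pair_of_offdiag_inverse)

lemma image_Abs_offdiag_inverse:
  "loopless U \<Longrightarrow> image_mset pair_of_offdiag (image_mset Abs_offdiag U) = U"
  by (induction U) (auto simp: pair_of_Abs_offdiag)

lemma edges_expo: "loopless U \<Longrightarrow> edges (expo (image_mset Abs_offdiag U)) = U"
  by (simp add: edges_def image_Abs_offdiag_inverse)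

lemma image_Abs_offdiag_inject:
  "loopless U \<Longrightarrow> loopless V \<Longrightarrow> image_mset Abs_offdiag U = image_mset Abs_offdiag V \<longleftrightarrow> U = V"
  by (metis image_Abs_offdiag_inverse)

lemma edge_monomial_add: "edge_monomial (U + V) = edge_monomial U * edge_monomial V"
  by (simp add: edge_monomial_def)

lemma ypoly_induct [case_names zero monomial add]:
  fixes p :: "'k::comm_ring_1 ypoly"
  assumes "P 0" "\<And>U c. loopless U \<Longrightarrow> P (Const c * edge_monomial U)"
    "\<And>p q. P p \<Longrightarrow> P q \<Longrightarrow> P (p + q)"
  shows "P p"
proof (induction p rule: mpoly_induct)
  case (single M c)
  have "Poly_Mapping.single (expo M) c = Const c * edge_monomial (edges (expo M))"
    by (simp add: edge_monomial_edges Const_mult_single)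
  then show ?case using assms(2)[OF loopless_edges] by metis
qed (use assms in auto)

lemma prod_mset_over_offdiag:
  assumes "loopless U"
  shows "(\<Prod>v\<in>#image_mset Abs_offdiag U. g (row v) (col v)) = (\<Prod>e\<in>#U. g (fst e) (snd e))"
  using assms by (induction U) (auto simp: row_def col_def pair_of_Abs_offdiag)

lemma subst_edge_monomial:
  assumes "loopless U"
  shows "subst (\<lambda>v. g (row v) (col v)) (edge_monomial U) = (\<Prod>e\<in>#U. g (fst e) (snd e))"
  using prod_mset_over_offdiag[OF assms, of g] by (simp add: subst_eq_lin edge_monomial_eq_single)

lemma perm_act_edge_monomial:
  assumes "loopless U"
  shows "perm_act \<sigma> (edge_monomial U) = edge_monomial (image_mset (map_prod \<sigma> \<sigma>) U)"
proof -
  have "perm_act \<sigma> (edge_monomial U) = (\<Prod>e\<in>#U. Y (\<sigma> (fst e)) (\<sigma> (snd e)))"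
    unfolding perm_act_def by (rule subst_edge_monomial[OF assms])
  then show ?thesis by (simp add: edge_monomial_def multiset.map_comp o_def)
qed

lemma perm_act_linear [simp]:
  "perm_act \<sigma> 0 = 0" "perm_act \<sigma> (p + q) = perm_act \<sigma> p + perm_act \<sigma> q"
  "perm_act \<sigma> (p - q) = perm_act \<sigma> p - perm_act \<sigma> q"
  "perm_act \<sigma> (Const c * p) = Const c * perm_act \<sigma> p"
  by (simp_all add: perm_act_def subst_eq_lin)

lemma mono_map_linear [simp]:
  "mono_map a b 0 = 0" "mono_map a b (p + q) = mono_map a b p + mono_map a b q"
  "mono_map a b (p - q) = mono_map a b p - mono_map a b q"
  "mono_map a b (Const c * p) = Const c * mono_map a b p"
  by (simp_all add: mono_map_def subst_eq_lin)

lemma mono_map_mult [simp]: "mono_map a b (p * q) = mono_map a b p * mono_map a b q"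
  by (simp add: mono_map_def subst_mult)

lemma X_power: "X i ^ n = Poly_Mapping.single (expo (replicate_mset n i)) 1"
  unfolding prod_mset_Var[symmetric] by (simp add: X_def)

lemma mono_map_edge_monomial:
  assumes "loopless U"
  shows "mono_map a b (edge_monomial U) = Poly_Mapping.single (expo (weight a b U)) 1"
proof -
  have "mono_map a b (edge_monomial U) = (\<Prod>e\<in>#U. X (fst e) ^ a * X (snd e) ^ b)"
    unfolding mono_map_def by (rule subst_edge_monomial[OF assms, of "\<lambda>i j. X i ^ a * X j ^ b"])
  also have "\<dots> = Poly_Mapping.single (expo (weight a b U)) 1"
    by (induction U) (simp_all add: X_power mult_single add.assoc)
  finally show ?thesis .
qed

lemma weight_image: "weight a b (image_mset (map_prod \<sigma> \<sigma>) U) = image_mset \<sigma> (weight a b U)"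
  by (induction U) simp_all

lemma loopless_image: "inj \<sigma> \<Longrightarrow> loopless U \<Longrightarrow> loopless (image_mset (map_prod \<sigma> \<sigma>) U)"
  by (auto simp: loopless_def inj_eq)

text \<open>The map \<open>\<pi>\<close> is equivariant; the outer map is the action of \<open>\<sigma>\<close> on \<open>K[X]\<close>.\<close>

lemma mono_map_perm_act:
  assumes "inj \<sigma>"
  shows "mono_map a b (perm_act \<sigma> p)
    = lin (\<lambda>t. Poly_Mapping.single (expo (image_mset \<sigma> (mset_of t))) 1) (mono_map a b p)"
proof (induction p rule: ypoly_induct)
  case (monomial U c)
  then show ?case
    using assms by (simp add: perm_act_edge_monomial mono_map_edge_monomial loopless_image weight_image
        del: mono_map_mult)
qed simp_all

lemma perm_act_in_ker: "bij \<sigma> \<Longrightarrow> p \<in> ker_mono_map a b \<Longrightarrow> perm_act \<sigma> p \<in> ker_mono_map a b"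
  by (simp add: ker_mono_map_def mono_map_perm_act bij_is_inj)

lemma subspace_ker: "ideal.subspace (ker_mono_map a b)"
  by (rule ideal.subspaceI) (simp_all add: ker_mono_map_def)

lemma binomial_in_ker:
  "loopless U \<Longrightarrow> loopless V \<Longrightarrow> weight a b U = weight a b V
    \<Longrightarrow> edge_monomial U - edge_monomial V \<in> ker_mono_map a b"
  by (simp add: ker_mono_map_def mono_map_edge_monomial)

text \<open>Choose one multigraph \<open>r t\<close> for each weight \<open>t\<close>. Modulo binomials, each monomial equals the chosen
one of its weight, so every \<open>q\<close> is congruent to a linear function of \<open>\<pi> q\<close>, which vanishes on the
kernel.\<close>

lemma ker_subset_ideal_if_binomials:
  fixes S :: "'k::comm_ring_1 ypoly set"
  assumes S: "\<And>U V. loopless U \<Longrightarrow> loopless V \<Longrightarrow> weight a b U = weight a b V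
      \<Longrightarrow> edge_monomial U - edge_monomial V \<in> ideal_generated S"
  shows "ker_mono_map a b \<subseteq> ideal_generated S"
proof
  fix p :: "'k ypoly"
  assume p: "p \<in> ker_mono_map a b"
  define r where "r t = (SOME U :: (pnat \<times> pnat) multiset. loopless U \<and> expo (weight a b U) = t)" for t
  have r: "loopless (r (expo (weight a b U))) \<and> weight a b (r (expo (weight a b U))) = weight a b U"
    if "loopless U" for U
  proof -
    have "loopless (r (expo (weight a b U))) \<and> expo (weight a b (r (expo (weight a b U)))) = expo (weight a b U)"
      unfolding r_def by (rule someI[of _ U]) (simp add: that)
    then show ?thesis by simp
  qed
  have "q - lin (\<lambda>t. edge_monomial (r t)) (mono_map a b q) \<in> ideal_generated S" for q :: "'k ypoly"
  proof (induction q rule: ypoly_induct)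
    case zero
    show ?case by (simp add: ideal.span_zero)
  next
    case (monomial U c)
    have "Const c * edge_monomial U - lin (\<lambda>t. edge_monomial (r t)) (mono_map a b (Const c * edge_monomial U))
      = Const c * (edge_monomial U - edge_monomial (r (expo (weight a b U))))"
      by (simp add: mono_map_edge_monomial[OF monomial] right_diff_distrib del: mono_map_mult)
    also have "\<dots> \<in> ideal_generated S"
      using r[OF monomial] monomial by (intro ideal.span_scale S) simp_all
    finally show ?case .
  next
    case (add p q)
    show ?case using ideal.span_add[OF add]
      by (simp add: algebra_simps)
  qed
  from this[of p] show "p \<in> ideal_generated S" using p by (simp add: ker_mono_map_def)
qed


section \<open>Permutations of the indices\<close>

lemma pnat_distinct: "distinct [1 :: pnat, 2, 3, 4]"
  by (simp add: nat_of_pnat_inject[symmetric] nat_of_pnat_one nat_of_pnat_numeral)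

lemma three_le_pnat: "3 \<le> nat_of_pnat j \<longleftrightarrow> j \<noteq> 1 \<and> j \<noteq> 2"
  using nat_of_pnat[of j]
  by (auto simp: nat_of_pnat_inject[symmetric] nat_of_pnat_one nat_of_pnat_numeral)

definition initial :: "nat \<Rightarrow> pnat set" where
  "initial n = {j. nat_of_pnat j \<le> n}"

lemma bij_betw_initial: "bij_betw nat_of_pnat (initial n) {1..n}"
proof (rule bij_betw_byWitness[where f' = Abs_pnat])
  show "nat_of_pnat ` initial n \<subseteq> {1..n}" using nat_of_pnat by (auto simp: initial_def Suc_le_eq)
qed (auto simp: initial_def Abs_pnat_inverse nat_of_pnat_inverse)

lemma finite_initial [simp]: "finite (initial n)" and card_initial [simp]: "card (initial n) = n"
  using bij_betw_initial[of n] by (simp_all add: bij_betw_finite bij_betw_same_card)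

text \<open>For an injection \<open>f\<close> on a finite set \<open>A\<close>, the sets \<open>f ` A - A\<close> and \<open>A - f ` A\<close> have the same size, so
\<open>f\<close> extends to a permutation of \<open>A \<union> f ` A\<close> and further by the identity.\<close>

lemma exists_bij_extending:
  fixes f :: "'a \<Rightarrow> 'a"
  assumes "finite A" "inj_on f A"
  shows "\<exists>\<sigma>. bij \<sigma> \<and> (\<forall>x\<in>A. \<sigma> x = f x)"
proof -
  have "card (f ` A - A) = card (A - f ` A)"
    using assms card_image[OF assms(2)] by (simp add: card_Diff_subset_Int Int_commute)
  then obtain g where g: "bij_betw g (f ` A - A) (A - f ` A)"
    using finite_same_card_bij[of "f ` A - A" "A - f ` A"] assms(1) by auto
  define \<sigma> where "\<sigma> x = (if x \<in> A then f x else if x \<in> f ` A then g x else x)" for x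
  have "bij_betw \<sigma> A (f ` A)"
    using assms(2) by (simp add: \<sigma>_def bij_betw_def inj_on_def image_def)
  moreover have "bij_betw \<sigma> (f ` A - A) (A - f ` A)"
    using g by (subst bij_betw_cong[of _ _ g]) (auto simp: \<sigma>_def)
  moreover have "bij_betw \<sigma> (- (A \<union> f ` A)) (- (A \<union> f ` A))"
    by (subst bij_betw_cong[of _ _ "\<lambda>x. x"]) (auto simp: \<sigma>_def bij_betw_def)
  ultimately have "bij_betw \<sigma> (A \<union> (f ` A - A) \<union> - (A \<union> f ` A)) (f ` A \<union> (A - f ` A) \<union> - (A \<union> f ` A))"
    by (intro bij_betw_combine) auto
  moreover have "A \<union> (f ` A - A) \<union> - (A \<union> f ` A) = UNIV" "f ` A \<union> (A - f ` A) \<union> - (A \<union> f ` A) = UNIV"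
    by auto
  ultimately have "bij \<sigma>" by simp
  moreover have "\<forall>x\<in>A. \<sigma> x = f x" by (simp add: \<sigma>_def)
  ultimately show ?thesis by blast
qed

lemma exists_bij_mapping_list:
  assumes "distinct xs" "distinct ys" "length xs = length ys"
  obtains \<sigma> :: "'a \<Rightarrow> 'a" where "bij \<sigma>" "map \<sigma> xs = ys"
proof -
  define f where "f x = the (map_of (zip xs ys) x)" for x
  have f: "map f xs = ys"
    using assms by (intro nth_equalityI) (auto simp: f_def map_of_zip_nth)
  then have "inj_on f (set xs)" using assms(2) distinct_map by metis
  then obtain \<sigma> where "bij \<sigma>" "\<forall>x\<in>set xs. \<sigma> x = f x"
    using exists_bij_extending[of "set xs" f] by blast
  then have "map \<sigma> xs = map f xs" by simp
  then show thesis using that[OF \<open>bij \<sigma>\<close>] f by metis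
qed


section \<open>The given binomials as differences of monomials of multigraphs\<close>

lemma binomials_i_eq:
  "binomials_i = {edge_monomial {#(1, 2), (3, 4)#} - edge_monomial {#(1, 4), (3, 2)#}}"
  by (simp add: binomials_i_def edge_monomial_def)

lemma binomials_ii_eq:
  "binomials_ii = {edge_monomial {#(1, 2), (2, 3), (3, 1)#} - edge_monomial {#(2, 1), (3, 2), (1, 3)#}}"
  by (simp add: binomials_ii_def edge_monomial_def)

lemma edge_monomial_double_star:
  "edge_monomial (double_star b x y C D)
    = Y x y ^ (b + size D) * (\<Prod>z\<in>#C. Y z y) * (\<Prod>z\<in>#D. Y y z)"
  by (simp add: double_star_def edge_monomial_def multiset.map_comp o_def)

lemma edge_monomial_double_star_over_keys:
  "edge_monomial (double_star b x y (mset_of c1) (mset_of c2)) = Y x y ^ (b + size (mset_of c2)) *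
     (\<Prod>j\<in>Poly_Mapping.keys c1 \<union> Poly_Mapping.keys c2.
       Y j y ^ Poly_Mapping.lookup c1 j * Y y j ^ Poly_Mapping.lookup c2 j)"
proof -
  have "(\<Prod>j\<in>#mset_of c. f j) = (\<Prod>j\<in>Poly_Mapping.keys c1 \<union> Poly_Mapping.keys c2. f j ^ Poly_Mapping.lookup c j)"
    if "c = c1 \<or> c = c2" for c :: "pnat \<Rightarrow>\<^sub>0 nat" and f :: "pnat \<Rightarrow> 'a ypoly"
    unfolding prod_mset_mset_of using that by (intro prod.mono_neutral_left) (auto simp: in_keys_iff)
  from this[of c1] this[of c2] show ?thesis
    unfolding edge_monomial_double_star by (simp only: prod.distrib mult.assoc simp_thms)
qed

lemma binomial_iii_eq:
  assumes "n = size (mset_of c2)"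
  shows "binomial_iii b n c1 c2 = edge_monomial (double_star b 1 2 (mset_of c1) (mset_of c2))
    - edge_monomial (double_star b 2 1 (mset_of c1) (mset_of c2))"
  unfolding edge_monomial_double_star_over_keys binomial_iii_def assms ..

lemma binomials_iii_eq:
  "binomials_iii a b = {edge_monomial (double_star b 1 2 C D) - edge_monomial (double_star b 2 1 C D) | C D.
     1 \<notin># C + D \<and> 2 \<notin># C + D \<and> size C + size D = a - b}" (is "_ = ?R")
proof
  show "binomials_iii a b \<subseteq> ?R"
  proof
    fix f :: "'a ypoly"
    assume "f \<in> binomials_iii a b"
    then obtain n c1 c2 where f: "f = binomial_iii b n c1 c2" "n \<le> a - b"
      "\<forall>j \<in> Poly_Mapping.keys c1 \<union> Poly_Mapping.keys c2. j \<noteq> 1 \<and> j \<noteq> 2"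
      "size (mset_of c1) = a - b - n" "size (mset_of c2) = n"
      unfolding binomials_iii_def three_le_pnat size_mset_of by blast
    show "f \<in> ?R"
      unfolding f(1) binomial_iii_eq[OF f(5)[symmetric]]
      using f by (intro CollectI exI[of _ "mset_of c1"] exI[of _ "mset_of c2"]) auto
  qed
  show "?R \<subseteq> binomials_iii a b"
  proof
    fix f :: "'a ypoly"
    assume "f \<in> ?R"
    then obtain C D where f: "f = edge_monomial (double_star b 1 2 C D) - edge_monomial (double_star b 2 1 C D)"
      "1 \<notin># C + D" "2 \<notin># C + D" "size C + size D = a - b" by blast
    have "f = binomial_iii b (size D) (expo C) (expo D)"
      by (subst binomial_iii_eq) (simp_all add: f(1))
    moreover have "\<forall>j \<in> set_mset C \<union> set_mset D. 3 \<le> nat_of_pnat j"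
      using f(2,3) by (auto simp: three_le_pnat)
    ultimately show "f \<in> binomials_iii a b"
      unfolding binomials_iii_def size_mset_of[symmetric] using f(4)
      by (intro CollectI exI[of _ "size D"] exI[of _ "expo C"] exI[of _ "expo D"]) auto
  qed
qed

lemma binomials_iv_eq:
  "binomials_iv a b = {edge_monomial (detour a b n 1 2 3) - edge_monomial (detour a b n 2 1 3) | n.
     1 \<le> n \<and> n \<le> b}"
  by (simp add: binomials_iv_def detour_def edge_monomial_def)

lemma weight_double_star:
  "size C + size D = a - b \<Longrightarrow> b < a \<Longrightarrow> weight a b (double_star b x y C D) = weight a b (double_star b y x C D)"
  using weight_eq_if_degrees_shifted[OF double_star_degrees] by metis

lemma weight_detour:
  "n \<le> b \<Longrightarrow> b < a \<Longrightarrow> weight a b (detour a b n x y z) = weight a b (detour a b n y x z)"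
  using weight_eq_if_degrees_shifted[OF detour_degrees] by metis

lemma size_double_star: "size (double_star b x y C D) = b + size C + 2 * size D"
  by (simp add: double_star_def)

lemma size_detour: "n \<le> b \<Longrightarrow> b < a \<Longrightarrow> size (detour a b n x y z) = a + n"
  by (simp add: detour_def)

lemma double_star_neq:
  assumes "0 < b" "x \<noteq> y" "x \<notin># C + D" "y \<notin># C + D"
  shows "double_star b x y C D \<noteq> double_star b y x C D"
proof -
  have "(x, y) \<in># double_star b x y C D" "(x, y) \<notin># double_star b y x C D"
    using assms by (auto simp: double_star_def)
  then show ?thesis by metis
qed

lemma detour_neq:
  assumes "distinct [x, y, z]" "1 \<le> n"
  shows "detour a b n x y z \<noteq> detour a b n y x z"
proof -
  have "(x, z) \<in># detour a b n x y z" "(x, z) \<notin># detour a b n y x z"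
    using assms by (auto simp: detour_def split: if_splits)
  then show ?thesis by metis
qed

lemma binomialE:
  assumes "0 < b" "b < a" "f \<in> binomials a b"
  obtains U V where "f = edge_monomial U - edge_monomial V" "loopless U" "loopless V" "U \<noteq> V"
    "weight a b U = weight a b V" "size U \<le> max (a + b) (2 * a - b)"
proof -
  note d = pnat_distinct
  have le: "3 \<le> max (a + b) (2 * a - b)" using assms(1,2) by simp
  from assms(3) consider "f \<in> binomials_i" | "f \<in> binomials_ii" | "f \<in> binomials_iii a b" | "f \<in> binomials_iv a b"
    unfolding binomials_def by blast
  then show thesis
  proof cases
    case 1
    then have f: "f = edge_monomial {#(1, 2), (3, 4)#} - edge_monomial {#(1, 4), (3, 2)#}"
      by (simp add: binomials_i_eq)
    have "(1, 2) \<in># {#(1, 2), (3, 4)#}" "(1 :: pnat, 2 :: pnat) \<notin># {#(1, 4), (3, 2)#}"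
      using d by auto
    then have "{#(1, 2), (3, 4)#} \<noteq> {#(1 :: pnat, 4 :: pnat), (3, 2)#}" by metis
    then show thesis
      using d le by (intro that[OF f]) (auto simp: ac_simps)
  next
    case 2
    then have f: "f = edge_monomial {#(1, 2), (2, 3), (3, 1)#} - edge_monomial {#(2, 1), (3, 2), (1, 3)#}"
      by (simp add: binomials_ii_eq)
    have "(1, 2) \<in># {#(1, 2), (2, 3), (3, 1)#}" "(1 :: pnat, 2 :: pnat) \<notin># {#(2, 1), (3, 2), (1, 3)#}"
      using d by auto
    then have "{#(1, 2), (2, 3), (3, 1)#} \<noteq> {#(2 :: pnat, 1 :: pnat), (3, 2), (1, 3)#}" by metis
    then show thesis
      using d le by (intro that[OF f]) (auto simp: ac_simps)
  next
    case 3
    then obtain C D where f: "f = edge_monomial (double_star b 1 2 C D) - edge_monomial (double_star b 2 1 C D)"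
      "1 \<notin># C + D" "2 \<notin># C + D" "size C + size D = a - b" unfolding binomials_iii_eq by blast
    show thesis
      using d f assms(1,2)
      by (intro that[OF f(1)] double_star_neq weight_double_star loopless_double_star) (auto simp: size_double_star)
  next
    case 4
    then obtain n where f: "f = edge_monomial (detour a b n 1 2 3) - edge_monomial (detour a b n 2 1 3)"
      "1 \<le> n" "n \<le> b" unfolding binomials_iv_eq by blast
    show thesis
      using d f assms(1,2)
      by (intro that[OF f(1)] detour_neq weight_detour loopless_detour) (auto simp: size_detour)
  qed
qed

lemma keys_single_diff:
  "m \<noteq> n \<Longrightarrow> Poly_Mapping.keys (Poly_Mapping.single m 1 - Poly_Mapping.single n (1 :: 'k::comm_ring_1)) = {m, n}"
  by (auto simp: in_keys_iff lookup_minus lookup_single when_def split: if_splits)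

lemma total_degree_binomial:
  assumes "loopless U" "loopless V" "U \<noteq> V" "size V = size U"
  shows "total_degree (edge_monomial U - edge_monomial V :: 'k::comm_ring_1 ypoly) = size U"
proof -
  let ?u = "expo (image_mset Abs_offdiag U)" and ?v = "expo (image_mset Abs_offdiag V)"
  have "?u \<noteq> ?v" using assms(1-3) by (simp add: image_Abs_offdiag_inject)
  then have "Poly_Mapping.keys (edge_monomial U - edge_monomial V :: 'k ypoly) = {?u, ?v}"
    unfolding edge_monomial_eq_single by (rule keys_single_diff)
  then show ?thesis
    unfolding total_degree_def size_mset_of[symmetric] by (simp add: assms(4))
qed

lemma total_degrees_of_binomials:
  assumes "0 < b" "b < a"
  shows "finite (total_degree ` (binomials a b :: 'k::comm_ring_1 ypoly set))"
    and "Max (total_degree ` (binomials a b :: 'k ypoly set)) = max (a + b) (2 * a - b)"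
proof -
  let ?T = "total_degree ` (binomials a b :: 'k ypoly set)"
  have bound: "t \<le> max (a + b) (2 * a - b)" if "t \<in> ?T" for t
  proof -
    from that obtain f :: "'k ypoly" where f: "f \<in> binomials a b" "t = total_degree f" by blast
    from assms f(1) obtain U V where UV: "f = edge_monomial U - edge_monomial V" "loopless U" "loopless V" "U \<noteq> V"
      "weight a b U = weight a b V" "size U \<le> max (a + b) (2 * a - b)" by (rule binomialE)
    then show ?thesis
      using total_degree_binomial[where 'k = 'k, OF UV(2-4)] weight_eq_imp_size_eq[OF assms(1) UV(5)] f(2) by simp
  qed
  then show fin: "finite ?T" by (meson finite_nat_set_iff_bounded_le)
  have "a + b \<in> ?T"
  proof -
    let ?f = "edge_monomial (detour a b b 1 2 3) - edge_monomial (detour a b b 2 1 3) :: 'k ypoly"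
    have "?f \<in> binomials a b" unfolding binomials_def binomials_iv_eq using assms by fastforce
    moreover have "total_degree ?f = a + b"
      using assms pnat_distinct
      by (subst total_degree_binomial[OF loopless_detour loopless_detour detour_neq]) (auto simp: size_detour)
    ultimately show ?thesis by force
  qed
  moreover have "2 * a - b \<in> ?T"
  proof -
    let ?D = "replicate_mset (a - b) (3 :: pnat)"
    let ?f = "edge_monomial (double_star b 1 2 {#} ?D) - edge_monomial (double_star b 2 1 {#} ?D) :: 'k ypoly"
    have "?f \<in> binomials_iii a b" unfolding binomials_iii_eq using pnat_distinct
      by (intro CollectI exI[of _ "{#}"] exI[of _ ?D]) auto
    moreover have "total_degree ?f = 2 * a - b"
      using assms pnat_distinct
      by (subst total_degree_binomial[OF loopless_double_star loopless_double_star double_star_neq])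
        (auto simp: size_double_star)
    ultimately show ?thesis unfolding binomials_def by force
  qed
  ultimately have "max (a + b) (2 * a - b) \<in> ?T" by (simp add: max_def)
  with bound fin show "Max ?T = max (a + b) (2 * a - b)" by (intro Max_eqI) auto
qed


section \<open>Binomials in an ideal form a congruence\<close>

definition binomial_rel ::
  "'k::comm_ring_1 ypoly set \<Rightarrow> (pnat \<times> pnat) multiset \<Rightarrow> (pnat \<times> pnat) multiset \<Rightarrow> bool" where
  "binomial_rel S U V \<longleftrightarrow> edge_monomial U - edge_monomial V \<in> ideal_generated S"

lemma edge_congruence_binomial_rel:
  assumes "\<And>i j k l. distinct [i, j, k, l] \<Longrightarrow> binomial_rel S {#(i, j), (k, l)#} {#(i, l), (k, j)#}"
    and "\<And>i j k. distinct [i, j, k] \<Longrightarrow>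
      binomial_rel S {#(i, j), (j, k), (k, i)#} {#(j, i), (k, j), (i, k)#}"
  shows "edge_congruence (binomial_rel S)"
proof
  fix u v w :: "(pnat \<times> pnat) multiset"
  show "binomial_rel S u u" by (simp add: binomial_rel_def ideal.span_zero)
  show "binomial_rel S v u" if "binomial_rel S u v"
    using ideal.span_neg that by (fastforce simp: binomial_rel_def)
  show "binomial_rel S u w" if "binomial_rel S u v" "binomial_rel S v w"
    using ideal.span_add that by (fastforce simp: binomial_rel_def)
  show "binomial_rel S (u + w) (v + w)" if "binomial_rel S u v"
    using ideal.span_scale[of _ S "edge_monomial w"] that
    by (fastforce simp: binomial_rel_def edge_monomial_add algebra_simps)
qed (fact assms)+

text \<open>The bridge between the combinatorics and the algebra, used both for the orbits of the given binomials
and for the orbits of a truncation.\<close>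

lemma weight_congruence_eq_ker:
  fixes S :: "'k::comm_ring_1 ypoly set"
  assumes "weight_congruence (binomial_rel S) a b" "coprime a b" "S \<subseteq> ker_mono_map a b"
  shows "ideal_generated S = ker_mono_map a b"
proof
  show "ideal_generated S \<subseteq> ker_mono_map a b"
    using assms(3) subspace_ker by (rule ideal.span_minimal)
  show "ker_mono_map a b \<subseteq> ideal_generated S"
    using weight_congruence.weight_eq_imp_congruent[OF assms(1,2)]
    by (intro ker_subset_ideal_if_binomials) (simp add: binomial_rel_def)
qed

lemma binomial_rel_orbit:
  fixes B :: "'k::comm_ring_1 ypoly set"
  assumes "edge_monomial U - edge_monomial V \<in> B" "loopless U" "loopless V" "bij \<sigma>"
  shows "binomial_rel (orbits B) (image_mset (map_prod \<sigma> \<sigma>) U) (image_mset (map_prod \<sigma> \<sigma>) V)"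
proof -
  have "perm_act \<sigma> (edge_monomial U - edge_monomial V) \<in> orbits B"
    using assms(1,4) unfolding orbits_def by blast
  then show ?thesis
    using assms(2,3) by (simp add: binomial_rel_def perm_act_edge_monomial ideal.span_base)
qed

lemma image_double_star:
  "image_mset (map_prod \<sigma> \<sigma>) (double_star b x y C D)
    = double_star b (\<sigma> x) (\<sigma> y) (image_mset \<sigma> C) (image_mset \<sigma> D)"
  by (simp add: double_star_def multiset.map_comp o_def)

lemma image_detour:
  "image_mset (map_prod \<sigma> \<sigma>) (detour a b n x y z) = detour a b n (\<sigma> x) (\<sigma> y) (\<sigma> z)"
  by (simp add: detour_def)

lemma weight_congruence_binomials:
  assumes "0 < b" "b < a"
  shows "weight_congruence (binomial_rel (orbits (binomials a b :: 'k::comm_ring_1 ypoly set))) a b"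
proof (intro weight_congruence.intro weight_congruence_axioms.intro edge_congruence_binomial_rel)
  let ?S = "orbits (binomials a b :: 'k ypoly set)"
  note d = pnat_distinct
  have orbit: "binomial_rel ?S (image_mset (map_prod \<sigma> \<sigma>) U) (image_mset (map_prod \<sigma> \<sigma>) V)"
    if "edge_monomial U - edge_monomial V \<in> (binomials a b :: 'k ypoly set)" "loopless U" "loopless V" "bij \<sigma>"
    for U V \<sigma> using binomial_rel_orbit[OF that] .
  show "binomial_rel ?S {#(i, j), (k, l)#} {#(i, l), (k, j)#}" if ds: "distinct [i, j, k, l]" for i j k l
  proof -
    obtain \<sigma> :: "pnat \<Rightarrow> pnat" where \<sigma>: "bij \<sigma>" "map \<sigma> [1, 2, 3, 4] = [i, j, k, l]"
      using exists_bij_mapping_list[OF d ds] by auto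
    have "loopless {#(1 :: pnat, 2), (3, 4)#}" "loopless {#(1 :: pnat, 4), (3, 2)#}" using d by auto
    from orbit[OF _ this \<sigma>(1)] \<sigma>(2) show ?thesis by (simp add: binomials_def binomials_i_eq)
  qed
  show "binomial_rel ?S {#(i, j), (j, k), (k, i)#} {#(j, i), (k, j), (i, k)#}"
    if ds: "distinct [i, j, k]" for i j k
  proof -
    obtain \<sigma> :: "pnat \<Rightarrow> pnat" where \<sigma>: "bij \<sigma>" "map \<sigma> [1, 2, 3] = [i, j, k]"
      using exists_bij_mapping_list[of "[1, 2, 3]", OF _ ds] d by auto
    have "loopless {#(1 :: pnat, 2), (2, 3), (3, 1)#}" "loopless {#(2 :: pnat, 1), (3, 2), (1, 3)#}"
      using d by auto
    from orbit[OF _ this \<sigma>(1)] \<sigma>(2) show ?thesis by (simp add: binomials_def binomials_ii_eq)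
  qed
  show "binomial_rel ?S (double_star b x y C D) (double_star b y x C D)"
    if xy: "x \<noteq> y" "x \<notin># C + D" "y \<notin># C + D" "size C + size D = a - b" for x y C D
  proof -
    obtain \<sigma> :: "pnat \<Rightarrow> pnat" where \<sigma>: "bij \<sigma>" "map \<sigma> [1, 2] = [x, y]"
      using exists_bij_mapping_list[of "[1, 2]" "[x, y]"] d xy(1) by auto
    define C' where "C' = image_mset (inv \<sigma>) C"
    define D' where "D' = image_mset (inv \<sigma>) D"
    have C': "image_mset \<sigma> C' = C" and D': "image_mset \<sigma> D' = D"
      using \<sigma>(1) by (simp_all add: C'_def D'_def multiset.map_comp o_def bij_is_surj surj_f_inv_f)
    have notin: "1 \<notin># C' + D'" "2 \<notin># C' + D'"
      using xy(2,3) \<sigma>(2) unfolding C'[symmetric] D'[symmetric] by auto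
    have "size C' + size D' = a - b" using xy(4) by (simp add: C'_def D'_def)
    then have "edge_monomial (double_star b 1 2 C' D') - edge_monomial (double_star b 2 1 C' D')
        \<in> (binomials a b :: 'k ypoly set)"
      using notin unfolding binomials_def binomials_iii_eq by blast
    moreover have "loopless (double_star b 1 2 C' D')" "loopless (double_star b 2 1 C' D')"
      using d notin by (auto intro!: loopless_double_star)
    ultimately show ?thesis
      using orbit[OF _ _ _ \<sigma>(1), of "double_star b 1 2 C' D'" "double_star b 2 1 C' D'"] \<sigma>(2)
      by (simp add: image_double_star C' D')
  qed
  show "binomial_rel ?S (detour a b n x y z) (detour a b n y x z)"
    if ds: "distinct [x, y, z]" and n: "1 \<le> n" "n \<le> b" for x y z n
  proof -
    obtain \<sigma> :: "pnat \<Rightarrow> pnat" where \<sigma>: "bij \<sigma>" "map \<sigma> [1, 2, 3] = [x, y, z]"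
      using exists_bij_mapping_list[of "[1, 2, 3]", OF _ ds] d by auto
    have "edge_monomial (detour a b n 1 2 3) - edge_monomial (detour a b n 2 1 3) \<in> (binomials a b :: 'k ypoly set)"
      using n unfolding binomials_def binomials_iv_eq by blast
    moreover have "loopless (detour a b n (1 :: pnat) 2 3)" "loopless (detour a b n (2 :: pnat) 1 3)"
      using d by (auto intro!: loopless_detour)
    ultimately show ?thesis
      using orbit[OF _ _ _ \<sigma>(1), of "detour a b n 1 2 3" "detour a b n 2 1 3"] \<sigma>(2)
      by (simp add: image_detour)
  qed
qed (use assms in auto)

lemma orbits_subset_ker: "B \<subseteq> ker_mono_map a b \<Longrightarrow> orbits B \<subseteq> ker_mono_map a b"
  unfolding orbits_def using perm_act_in_ker by blast

theorem ideal_of_binomials: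
  assumes "0 < b" "b < a" "coprime a b"
  shows "ideal_generated (orbits (binomials a b)) = (ker_mono_map a b :: 'k::comm_ring_1 ypoly set)"
proof (rule weight_congruence_eq_ker[OF weight_congruence_binomials[OF assms(1,2)] assms(3)])
  show "orbits (binomials a b) \<subseteq> (ker_mono_map a b :: 'k ypoly set)"
    by (rule orbits_subset_ker) (auto elim!: binomialE[OF assms(1,2)] intro: binomial_in_ker)
qed


section \<open>Generation by the truncated kernel\<close>

definition vertices :: "('v \<times> 'v) multiset \<Rightarrow> 'v set" where
  "vertices U = fst ` set_mset U \<union> snd ` set_mset U"

lemma vertices_simps [simp]:
  "vertices {#} = {}" "vertices (add_mset e U) = {fst e, snd e} \<union> vertices U"
  by (auto simp: vertices_def)

lemma vertices_image: "vertices (image_mset (map_prod \<sigma> \<sigma>) U) = \<sigma> ` vertices U"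
  by (induction U) auto

lemma vertices_double_star: "vertices (double_star b x y C D) \<subseteq> {x, y} \<union> set_mset C \<union> set_mset D"
  by (auto simp: vertices_def double_star_def)

lemma vertices_detour: "vertices (detour a b n x y z) \<subseteq> {x, y, z}"
  by (auto simp: vertices_def detour_def)

lemma truncation_iff:
  "p \<in> truncation n \<longleftrightarrow> (\<forall>m\<in>Poly_Mapping.keys p. vertices (edges m) \<subseteq> initial n)"
  unfolding truncation_def vars_def vertices_def edges_def row_def col_def initial_def
  by (simp add: image_subset_iff) blast

lemma binomial_in_truncation:
  assumes "loopless U" "loopless V" "vertices U \<subseteq> initial n" "vertices V \<subseteq> initial n"
  shows "edge_monomial U - edge_monomial V \<in> truncation n"
proof -
  have "Poly_Mapping.keys (edge_monomial U - edge_monomial V)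
      \<subseteq> {expo (image_mset Abs_offdiag U), expo (image_mset Abs_offdiag V)}"
    unfolding edge_monomial_eq_single
    by (rule order_trans[OF keys_diff]) (auto simp: keys_single split: if_splits)
  then show ?thesis unfolding truncation_iff using assms edges_expo by fastforce
qed

text \<open>Vertices in a set of at most \<open>N\<close> elements can be renamed to indices up to \<open>N\<close>; the renamed binomial
lies in the truncation and the original one in its orbit.\<close>

lemma binomial_rel_truncation:
  assumes U: "loopless U" "loopless V" "weight a b U = weight a b V"
    and A: "finite A" "card A \<le> N" "vertices U \<union> vertices V \<subseteq> A"
  shows "binomial_rel (orbits (ker_mono_map a b \<inter> truncation N :: 'k::comm_ring_1 ypoly set)) U V"
proof -
  obtain f where f: "inj_on f A" "f ` A \<subseteq> initial N"
    using A(1,2) by (metis card_initial card_le_inj finite_initial)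
  obtain \<sigma> where \<sigma>: "bij \<sigma>" "\<forall>x\<in>A. \<sigma> x = f x" using exists_bij_extending[OF A(1) f(1)] by blast
  have img: "\<sigma> ` A \<subseteq> initial N" using f(2) \<sigma>(2) by auto
  let ?U = "image_mset (map_prod \<sigma> \<sigma>) U" and ?V = "image_mset (map_prod \<sigma> \<sigma>) V"
  have UV: "loopless ?U" "loopless ?V" using U \<sigma>(1) by (auto intro: loopless_image bij_is_inj)
  have "edge_monomial ?U - edge_monomial ?V \<in> (ker_mono_map a b \<inter> truncation N :: 'k ypoly set)"
    using U UV A(3) img
    by (intro IntI binomial_in_ker binomial_in_truncation) (auto simp: weight_image vertices_image)
  from binomial_rel_orbit[OF this UV, of "inv \<sigma>"] \<sigma>(1)
  show ?thesis
    by (simp add: bij_imp_bij_inv multiset.map_comp map_prod.comp map_prod.id bij_is_inj)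
qed

lemma card_set_mset_le: "card (set_mset M) \<le> size M"
  by (induction M) (simp_all add: card_insert_if)

lemma weight_congruence_truncation:
  assumes "0 < b" "b < a" "4 \<le> N" "a - b + 2 \<le> N"
  shows "weight_congruence (binomial_rel (orbits (ker_mono_map a b \<inter> truncation N :: 'k::comm_ring_1 ypoly set))) a b"
proof (intro weight_congruence.intro weight_congruence_axioms.intro edge_congruence_binomial_rel)
  let ?S = "orbits (ker_mono_map a b \<inter> truncation N :: 'k ypoly set)"
  have card_le: "card (set xs) \<le> N" if "length xs \<le> N" for xs :: "pnat list"
    using that card_length order_trans by blast
  show "binomial_rel ?S {#(i, j), (k, l)#} {#(i, l), (k, j)#}" if "distinct [i, j, k, l]" for i j k l
    using that card_le[of "[i, j, k, l]"] assms(3)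
    by (intro binomial_rel_truncation[of _ _ _ _ "set [i, j, k, l]"]) (auto simp: ac_simps)
  show "binomial_rel ?S {#(i, j), (j, k), (k, i)#} {#(j, i), (k, j), (i, k)#}"
    if "distinct [i, j, k]" for i j k
    using that card_le[of "[i, j, k]"] assms(3)
    by (intro binomial_rel_truncation[of _ _ _ _ "set [i, j, k]"]) (auto simp: ac_simps)
  show "binomial_rel ?S (double_star b x y C D) (double_star b y x C D)"
    if xy: "x \<noteq> y" "x \<notin># C + D" "y \<notin># C + D" "size C + size D = a - b" for x y C D
  proof (rule binomial_rel_truncation)
    let ?A = "{x, y} \<union> set_mset C \<union> set_mset D"
    have "card ?A \<le> card {x, y} + card (set_mset C) + card (set_mset D)"
      by (meson card_Un_le add_le_mono order_trans order_refl)
    also have "\<dots> \<le> 2 + size C + size D"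
      using card_insert_le_m1[of 2 "{y}" x] card_set_mset_le by (intro add_mono) auto
    finally show "card ?A \<le> N" using xy(4) assms(4) by simp
    show "vertices (double_star b x y C D) \<union> vertices (double_star b y x C D) \<subseteq> ?A"
      using vertices_double_star by fast
  qed (use xy assms in \<open>auto intro: loopless_double_star weight_double_star\<close>)
  show "binomial_rel ?S (detour a b n x y z) (detour a b n y x z)"
    if ds: "distinct [x, y, z]" and n: "1 \<le> n" "n \<le> b" for x y z n
  proof (rule binomial_rel_truncation)
    show "card (set [x, y, z]) \<le> N" using assms(3) by (intro card_le) simp
    show "vertices (detour a b n x y z) \<union> vertices (detour a b n y x z) \<subseteq> set [x, y, z]"
      using vertices_detour by fastforce
  qed (use ds n assms in \<open>auto intro!: loopless_detour weight_detour\<close>)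
qed (use assms in auto)


section \<open>Smaller truncations\<close>

text \<open>This makes fibres visible: the coefficient of \<open>\<pi> p\<close> at a weight is the sum of the coefficients of \<open>p\<close>
over all monomials of that weight.\<close>

lemma mono_map_expansion:
  "mono_map a b p = (\<Sum>m\<in>Poly_Mapping.keys p.
     Poly_Mapping.single (expo (weight a b (edges m))) (Poly_Mapping.lookup p m))"
proof -
  have "(\<Prod>v\<in>#mset_of m. X (row v) ^ a * X (col v) ^ b :: 'a xpoly)
      = Poly_Mapping.single (expo (weight a b (edges m))) 1" for m
    using mono_map_edge_monomial[OF loopless_edges, of a b m, where 'a = 'a]
    by (simp add: edge_monomial_edges mono_map_def subst_eq_lin)
  then show ?thesis
    unfolding mono_map_def subst_eq_lin lin_def by (simp add: Const_mult_single)
qed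

lemma keys_perm_act:
  assumes "bij \<sigma>" "p \<in> truncation n" "m \<in> Poly_Mapping.keys (perm_act \<sigma> p)"
  shows "vertices (edges m) \<subseteq> \<sigma> ` initial n"
proof -
  have "perm_act \<sigma> p = (\<Sum>k\<in>Poly_Mapping.keys p.
      Const (Poly_Mapping.lookup p k) * edge_monomial (image_mset (map_prod \<sigma> \<sigma>) (edges k)))"
    unfolding perm_act_def subst_eq_lin lin_def
    by (simp add: edge_monomial_def edges_def row_def col_def multiset.map_comp o_def)
  then obtain k where k: "k \<in> Poly_Mapping.keys p"
      "m \<in> Poly_Mapping.keys (Const (Poly_Mapping.lookup p k) * edge_monomial (image_mset (map_prod \<sigma> \<sigma>) (edges k)))"
    using assms(3) keys_sum by fastforce
  let ?U = "image_mset (map_prod \<sigma> \<sigma>) (edges k)"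
  have "m = expo (image_mset Abs_offdiag ?U)"
    using k(2) by (simp add: edge_monomial_eq_single Const_mult_single split: if_splits)
  then have "edges m = ?U"
    using edges_expo[OF loopless_image] loopless_edges bij_is_inj[OF assms(1)] by blast
  then show ?thesis
    using assms(2) k(1) by (auto simp: truncation_iff vertices_image)
qed

lemma edges_inject [simp]: "edges m = edges m' \<longleftrightarrow> m = m'"
proof -
  have "expo (image_mset Abs_offdiag (edges m)) = m" for m
    by (simp add: edges_def multiset.map_comp o_def pair_of_offdiag_inverse)
  then show ?thesis by metis
qed

text \<open>The polynomials without any monomial dividing \<open>U\<close> form an ideal \<open>S\<close>, which does not contain the
binomial \<open>U - V\<close>. An element of the kernel with only \<open>n\<close> indices lies in \<open>S\<close>: a divisor of \<open>U\<close> in its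
support would be proper, as \<open>U\<close> has more than \<open>n\<close> indices, hence alone in its fibre, so that its
coefficient would survive in the image under \<open>\<pi>\<close>.\<close>

lemma truncation_too_small:
  fixes U V :: "(pnat \<times> pnat) multiset"
  assumes UV: "loopless U" "loopless V" "weight a b U = weight a b V" "U \<noteq> V"
    and n: "n < card (vertices U)"
    and isolated: "\<And>W W'. W \<subset># U \<Longrightarrow> weight a b W' = weight a b W \<Longrightarrow> W' = W"
  shows "ideal_generated (orbits (ker_mono_map a b \<inter> truncation n)) \<noteq> (ker_mono_map a b :: 'k::comm_ring_1 ypoly set)"
proof -
  define S :: "'k ypoly set" where "S = {p. \<forall>m N. U = edges m + N \<longrightarrow> Poly_Mapping.lookup p m = 0}"
  have "ideal.subspace S"
  proof (rule ideal.subspaceI)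
    fix c p :: "'k ypoly"
    assume p: "p \<in> S"
    have "Poly_Mapping.lookup (c * p) k = 0" if "U = edges k + N" for k N
    proof -
      have "(Poly_Mapping.lookup p q when k = l + q) = 0" for l q
      proof (cases "k = l + q")
        case True
        then have "U = edges q + (edges l + N)"
          using that by (simp add: edges_def ac_simps)
        then have "Poly_Mapping.lookup p q = 0" using p unfolding S_def by blast
        then show ?thesis by simp
      qed simp
      then show ?thesis by (simp add: lookup_mult)
    qed
    then show "c * p \<in> S" by (auto simp: S_def)
  qed (auto simp: S_def lookup_add)
  moreover have "orbits (ker_mono_map a b \<inter> truncation n) \<subseteq> S"
  proof
    fix f :: "'k ypoly"
    assume "f \<in> orbits (ker_mono_map a b \<inter> truncation n)"
    then obtain \<sigma> g where g: "f = perm_act \<sigma> g" "bij \<sigma>" "g \<in> ker_mono_map a b" "g \<in> truncation n"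
      unfolding orbits_def by blast
    have f: "mono_map a b f = 0" using perm_act_in_ker[OF g(2,3)] by (simp add: g(1) ker_mono_map_def)
    have "Poly_Mapping.lookup f m = 0" if mN: "U = edges m + N" for m N
    proof (rule ccontr)
      assume nz: "Poly_Mapping.lookup f m \<noteq> 0"
      then have m: "m \<in> Poly_Mapping.keys f" by (simp add: in_keys_iff)
      have "vertices (edges m) \<subseteq> \<sigma> ` initial n" using keys_perm_act[OF g(2,4)] m g(1) by simp
      then have "card (vertices (edges m)) \<le> n"
        using card_mono[of "\<sigma> ` initial n" "vertices (edges m)"] card_image_le[of "initial n" \<sigma>] by simp
      then have "edges m \<subset># U" using n mN by (metis mset_subset_eq_add_left not_le subset_mset.le_neq_trans)
      then have unique: "m' = m" if "weight a b (edges m') = weight a b (edges m)" for m'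
        using isolated[OF _ that] by simp
      have "Poly_Mapping.lookup (mono_map a b f) (expo (weight a b (edges m)))
          = (\<Sum>k\<in>Poly_Mapping.keys f. if k = m then Poly_Mapping.lookup f k else 0)"
        unfolding mono_map_expansion lookup_sum lookup_single when_def
        by (rule sum.cong) (use unique in auto)
      also have "\<dots> = Poly_Mapping.lookup f m" using m by simp
      finally show False using f nz by simp
    qed
    then show "f \<in> S" by (auto simp: S_def)
  qed
  ultimately have J: "ideal_generated (orbits (ker_mono_map a b \<inter> truncation n)) \<subseteq> S"
    by (intro ideal.span_minimal)
  let ?f = "edge_monomial U - edge_monomial V :: 'k ypoly" and ?m = "expo (image_mset Abs_offdiag U)"
  have "Poly_Mapping.lookup ?f ?m = 1"
    using UV by (simp add: edge_monomial_eq_single lookup_minus lookup_single image_Abs_offdiag_inject when_def)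
  moreover have "U = edges ?m + {#}" by (simp add: edges_expo UV(1))
  ultimately have "?f \<notin> S" unfolding S_def by force
  moreover have "?f \<in> ker_mono_map a b" using UV by (intro binomial_in_ker)
  ultimately show ?thesis using J by blast
qed

text \<open>By \<open>coprime_combination_shift\<close>, other degrees would require some indegree to be at least \<open>a\<close>, more
than there are edges.\<close>

lemma weight_eq_imp_same_degrees:
  assumes "coprime a b" "0 < b" "size u < a" "weight a b u = weight a b v"
  shows "same_degrees u v"
proof -
  have a: "0 < a" using assms(3) by simp
  have less: "count (image_mset snd w) i < a" if "size w = size u" for w :: "('a \<times> 'a) multiset" and i
    using count_le_size[of "image_mset snd w" i] that assms(3) by simp
  have eq: "a * count (image_mset fst u) i + b * count (image_mset snd u) i
     = a * count (image_mset fst v) i + b * count (image_mset snd v) i" for i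
    using arg_cong[OF assms(4), of "\<lambda>M. count M i"] by (simp add: count_weight)
  have sz: "size v = size u" using weight_eq_imp_size_eq[OF assms(2,4)] by simp
  have noshift: False if "0 < s" "n' = n + a * s" "n' < a" for n n' s :: nat
    using that by (cases s) auto
  have out: "count (image_mset fst u) i = count (image_mset fst v) i" for i
  proof (rule linorder_cases)
    assume "count (image_mset fst u) i < count (image_mset fst v) i"
    then show ?thesis
      using coprime_combination_shift[OF eq[symmetric] _ assms(1) a assms(2)] noshift less[of u i] by metis
  next
    assume "count (image_mset fst v) i < count (image_mset fst u) i"
    then show ?thesis
      using coprime_combination_shift[OF eq _ assms(1) a assms(2)] noshift less[OF sz, of i] by metis
  qed
  then have "count (image_mset snd u) i = count (image_mset snd v) i" for i
    using eq[of i] assms(2) by simp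
  with out show ?thesis by (auto simp: same_degrees_def intro: multiset_eqI)
qed

text \<open>If all edges end in \<open>y\<close>, which the indegrees show, the outdegrees list the edges.\<close>

lemma in_star_determined_by_degrees:
  assumes "\<forall>e\<in>#W. snd e = y" "same_degrees W W'"
  shows "W' = W"
proof -
  have star: "M = image_mset (\<lambda>z. (z, y)) (image_mset fst M)" if "\<forall>e\<in>#M. snd e = y" for M :: "('a \<times> 'a) multiset"
    using that by (induction M) auto
  have "set_mset (image_mset snd W') = set_mset (image_mset snd W)"
    using assms(2) by (simp add: same_degrees_def)
  then have "\<forall>e\<in>#W'. snd e = y" using assms(1) by force
  then show ?thesis using star[of W] star[of W'] assms by (metis same_degrees_def)
qed

text \<open>The binomial (i) obstructs: a proper divisor of its first term has at most one edge.\<close>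

lemma truncation_below_four:
  assumes "coprime a b" "0 < b" "b < a" "n < 4"
  shows "ideal_generated (orbits (ker_mono_map a b \<inter> truncation n)) \<noteq> (ker_mono_map a b :: 'k::comm_ring_1 ypoly set)"
proof (rule truncation_too_small)
  let ?U = "{#(1, 2), (3, 4)#} :: (pnat \<times> pnat) multiset"
  note d = pnat_distinct
  show "loopless ?U" "loopless {#(1 :: pnat, 4), (3, 2)#}" using d by auto
  show "weight a b ?U = weight a b {#(1, 4), (3, 2)#}" by (simp add: ac_simps)
  have "(1, 2) \<in># ?U" "(1, 2) \<notin># {#(1 :: pnat, 4 :: pnat), (3, 2)#}" using d by auto
  then show "?U \<noteq> {#(1, 4), (3, 2)#}" by metis
  have "vertices ?U = {1, 2, 3, 4}" by auto
  then show "n < card (vertices ?U)" using d assms(4) by simp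
  fix W W' :: "(pnat \<times> pnat) multiset"
  assume W: "W \<subset># ?U" "weight a b W' = weight a b W"
  have sz: "size W \<le> 1" using mset_subset_size[OF W(1)] by simp
  then have "size W < a" using assms(2,3) by simp
  then have "same_degrees W W'" using weight_eq_imp_same_degrees[OF assms(1,2) _ W(2)[symmetric]] by simp
  moreover obtain y where "\<forall>e\<in>#W. snd e = y"
  proof (cases W)
    case (add e M)
    then show ?thesis using that[of "snd e"] sz by simp
  qed (use that in simp)
  ultimately show "W' = W" by (metis in_star_determined_by_degrees)
qed

text \<open>The binomial (iii) with \<open>n = 0\<close> and \<open>c\<^sub>1\<^sub>j = 1\<close> for \<open>3 \<le> j \<le> a - b + 2\<close> obstructs. Its first term has
exactly \<open>a\<close> edges, all of them into the vertex 2.\<close>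

lemma truncation_below_star:
  assumes "coprime a b" "0 < b" "b < a" "n < a - b + 2"
  shows "ideal_generated (orbits (ker_mono_map a b \<inter> truncation n)) \<noteq> (ker_mono_map a b :: 'k::comm_ring_1 ypoly set)"
proof (rule truncation_too_small)
  let ?A = "initial (a - b + 2)"
  have one_two: "{1, 2} \<subseteq> ?A"
    by (simp add: initial_def nat_of_pnat_one nat_of_pnat_numeral)
  have "(1 :: pnat) \<noteq> 2" using pnat_distinct by simp
  define C where "C = mset_set (?A - {1, 2})"
  have setC: "set_mset C = ?A - {1, 2}" by (simp add: C_def)
  have sizeC: "size C = a - b" using one_two \<open>1 \<noteq> 2\<close> by (simp add: C_def card_Diff_subset)
  let ?U = "double_star b 1 2 C {#}" and ?V = "double_star b 2 1 C {#}"
  have notin: "1 \<notin># C + {#}" "2 \<notin># C + {#}" by (simp_all add: setC)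
  show "loopless ?U" by (rule loopless_double_star[OF \<open>1 \<noteq> 2\<close> notin(2)])
  show "loopless ?V" by (rule loopless_double_star[OF \<open>1 \<noteq> 2\<close>[symmetric] notin(1)])
  show "weight a b ?U = weight a b ?V" using sizeC by (intro weight_double_star[OF _ assms(3)]) simp
  show "?U \<noteq> ?V" by (rule double_star_neq[OF assms(2) \<open>1 \<noteq> 2\<close> notin])
  have "vertices ?U = ?A"
    using one_two assms(2) setC by (auto simp: vertices_def double_star_def image_image)
  then show "n < card (vertices ?U)" using assms(4) by simp
  fix W W' :: "(pnat \<times> pnat) multiset"
  assume W: "W \<subset># ?U" "weight a b W' = weight a b W"
  have "size W < a" using mset_subset_size[OF W(1)] sizeC assms(3) by (simp add: size_double_star)
  then have "same_degrees W W'" using weight_eq_imp_same_degrees[OF assms(1,2) _ W(2)[symmetric]] by simp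
  moreover have "\<forall>e\<in>#W. snd e = 2"
  proof
    fix e
    assume "e \<in># W"
    then have "e \<in># ?U" using W(1) by (metis mset_subset_eqD subset_mset.less_imp_le)
    then show "snd e = 2" by (auto simp: double_star_def split: if_splits)
  qed
  ultimately show "W' = W" by (metis in_star_determined_by_degrees)
qed

theorem width_of_ker:
  assumes "0 < b" "b < a" "coprime a b"
  shows "width (ker_mono_map a b :: 'k::comm_ring_1 ypoly set) = enat (max 4 (a - b + 2))"
proof (rule antisym)
  let ?I = "ker_mono_map a b :: 'k ypoly set" and ?N = "max 4 (a - b + 2)"
  have "ideal_generated (orbits (?I \<inter> truncation ?N)) = ?I"
    using assms by (intro weight_congruence_eq_ker weight_congruence_truncation orbits_subset_ker) auto
  then show "width ?I \<le> enat ?N" unfolding width_def by (intro Inf_lower) blast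
  have "?N \<le> n" if "ideal_generated (orbits (?I \<inter> truncation n)) = ?I" for n
    using that truncation_below_four[OF assms(3,1,2), of n] truncation_below_star[OF assms(3,1,2), of n] by force
  then show "enat ?N \<le> width ?I" unfolding width_def by (intro Inf_greatest) auto
qed

theorem theorem4p7:
  fixes a b :: nat
  assumes "0 < b" and "b < a" and "coprime a b"
  shows "equivariant_markov_basis (binomials a b :: 'k::comm_ring_1 ypoly set) (ker_mono_map a b)
    \<and> finite (total_degree ` (binomials a b :: 'k ypoly set))
    \<and> Max (total_degree ` (binomials a b :: 'k ypoly set)) = max (a + b) (2 * a - b)
    \<and> width (ker_mono_map a b :: 'k ypoly set) = enat (max 4 (a - b + 2))"
  unfolding equivariant_markov_basis_def
  using ideal_of_binomials[OF assms] total_degrees_of_binomials[OF assms(1,2)] width_of_ker[OF assms]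
  by simp

end
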